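(* Let $n$ be an odd prime. Assume that $(x_0,x_1,x_2,x_3,x_4)\in G^5$ satisfies $$(\tan x_0)^2=(\tan x_1)(\tan x_2)(\tan x_3)(\tan x_4),$$ with $0<x_i<\frac{\pi}{2}$ and $\operatorname{den}(x_i)\in\{n,2n,4n\}$ for each $0\le i\le 4$. Then there exist a permutation $\sigma$ of $\{1,2,3,4\}$ and rational numbers $s,t$ with $0<s<\frac12$ and $0<t\le\frac14$ such that $$x_0=s\pi,\quad x_{\sigma(1)}=x_{\sigma(2)}=s\pi,\quad x_{\sigma(3)}=t\pi,\quad x_{\sigma(4)}=\left(\tfrac12-t\right)\pi.$$
   Context: $G:=\mathbb{Q}\pi=\{r\pi\mid r\in\mathbb{Q}\}$. For a nonzero $g\in G$, $\operatorname{den}(g)$ denotes the denominator of the rational number $g/\pi$ written in lowest terms. *)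

theory Defs
  imports "HOL-Analysis.Analysis"
begin

text \<open>The group of rational multiples of \<open>\<pi>\<close>.\<close>

definition G :: "real set" where
  "G = {of_rat r * pi | r :: rat. True}"

text \<open>The function below is meaningful on \<open>G\<close> only, where the rational number \<open>r\<close> is unique.
  The second component of \<^const>\<open>quotient_of\<close> is the positive denominator in lowest terms.\<close>

definition den :: "real \<Rightarrow> nat" where
  "den g = nat (snd (quotient_of (THE r :: rat. g = of_rat r * pi)))"

lemma den_of_rat_pi: "den (of_rat r * pi) = nat (snd (quotient_of r))"
  unfolding den_def by simp

end

theory Submission
  imports Defs "HOL-Computational_Algebra.Computational_Algebra" "HOL-Number_Theory.Cong"
begin

text \<open>
  Write the angles as \<open>\<pi> a / (4 n)\<close>. The relation is a polynomial identity in a primitive \<open>4 n\<close>-th root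
  of unity, so it persists, up to sign, when all angles are multiplied by some \<open>k\<close> coprime to \<open>4 n\<close>.
  Taking logarithms gives a linear relation between the functions \<open>k \<mapsto> ln \<bar>tan (k \<pi> a / (4 n))\<bar>\<close>
  with at most five terms, once complementary angles, whose functions are negatives of each
  other, have been identified.

  These functions are nearly orthogonal to cosines. The Fourier series
  \<open>ln \<bar>tan (\<theta> / 2)\<bar> = - 2 (cos \<theta> + cos (3 \<theta>) / 3 + cos (5 \<theta>) / 5 + \<dots>)\<close> shows that summing the function
  of \<open>a\<close> over \<open>k\<close> against \<open>cos (2 \<pi> k b / (4 n))\<close> (minus 1 if \<open>b\<close> is even) gives 0 if \<open>a\<close> and \<open>b\<close>
  have different parity, and otherwise at most \<open>2 n / r\<close> in absolute value, where \<open>r < n\<close> is the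
  odd number with \<open>a r \<equiv> \<plusminus>b\<close> modulo \<open>2 n\<close>; for \<open>a = b\<close>, that is \<open>r = 1\<close>, it is at least
  \<open>2 n (1 - 2 / n)\<close>. Distinct \<open>a\<close> have distinct \<open>r\<close>, and
  \<open>1 / 3 + 1 / 5 + 1 / 7 + 1 / 9 < 1 - 2 / 11\<close>, so testing against a \<open>b\<close> with coefficient of
  largest absolute value shows that all coefficients vanish.
\<close>

subsection \<open>Conjugates of roots of unity\<close>

definition ipoly_eval :: "int poly \<Rightarrow> complex \<Rightarrow> complex" where
  "ipoly_eval p z = poly (map_poly of_int p) z"

lemma ipoly_eval_0 [simp]: "ipoly_eval 0 z = 0"
  by (simp add: ipoly_eval_def)

lemma ipoly_eval_pCons [simp]: "ipoly_eval (pCons a p) z = of_int a + z * ipoly_eval p z"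
  by (simp add: ipoly_eval_def map_poly_pCons)

lemma ipoly_eval_1 [simp]: "ipoly_eval 1 z = 1"
  by (simp add: one_pCons)

lemma ipoly_eval_add [simp]: "ipoly_eval (p + q) z = ipoly_eval p z + ipoly_eval q z"
  by (induction p q rule: poly_induct2) (simp_all add: algebra_simps)

lemma ipoly_eval_smult [simp]: "ipoly_eval (smult c p) z = of_int c * ipoly_eval p z"
  by (induction p) (simp_all add: algebra_simps)

lemma ipoly_eval_minus [simp]: "ipoly_eval (- p) z = - ipoly_eval p z"
  by (induction p) simp_all

lemma ipoly_eval_diff [simp]: "ipoly_eval (p - q) z = ipoly_eval p z - ipoly_eval q z"
  using ipoly_eval_add[of p "- q"] by simp

lemma ipoly_eval_mult [simp]: "ipoly_eval (p * q) z = ipoly_eval p z * ipoly_eval q z"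
  by (induction p) (simp_all add: algebra_simps)

lemma ipoly_eval_power [simp]: "ipoly_eval (p ^ k) z = ipoly_eval p z ^ k"
  by (induction k) simp_all

lemma ipoly_eval_of_nat [simp]: "ipoly_eval (of_nat k) z = of_nat k"
  by (induction k) simp_all

lemma ipoly_eval_monom [simp]: "ipoly_eval (monom a k) z = of_int a * z ^ k"
  by (induction k) (simp_all add: monom_0 monom_Suc)

lemma ipoly_eval_pcompose: "ipoly_eval (pcompose p q) z = ipoly_eval p (ipoly_eval q z)"
  by (induction p) (simp_all add: pcompose_pCons)

text \<open>In the binomial expansion, the coefficients strictly between the two ends are all
  divisible by the prime \<open>q\<close>.\<close>

lemma prime_dvd_add_power_diff:
  fixes u v :: "'a :: comm_ring_1"
  assumes "prime q"
  shows "of_nat q dvd (u + v) ^ q - (u ^ q + v ^ q)"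
proof -
  have q: "q > 0" using assms by (simp add: prime_gt_0_nat)
  have "(u + v) ^ q = (\<Sum>k\<le>q. of_nat (q choose k) * u ^ k * v ^ (q - k))"
    by (rule binomial_ring)
  also have "{..q} = insert 0 (insert q {1..<q})" using q by auto
  also have "(\<Sum>k\<in>\<dots>. of_nat (q choose k) * u ^ k * v ^ (q - k))
      = v ^ q + (u ^ q + (\<Sum>k\<in>{1..<q}. of_nat (q choose k) * u ^ k * v ^ (q - k)))"
    using q by simp
  finally have "(u + v) ^ q - (u ^ q + v ^ q)
      = (\<Sum>k\<in>{1..<q}. of_nat (q choose k) * u ^ k * v ^ (q - k))" by simp
  moreover have "of_nat q dvd (of_nat (q choose k) * u ^ k * v ^ (q - k) :: 'a)"
    if "k \<in> {1..<q}" for k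
  proof -
    have "q dvd q choose k" using that assms
      by (intro dvd_choose_prime) auto
    then obtain c where "q choose k = q * c" by (elim dvdE)
    then show ?thesis by (simp add: mult.assoc)
  qed
  ultimately show ?thesis by (auto intro!: dvd_sum)
qed

text \<open>Fermat's little theorem. The previous lemma with second summand 1 transfers the claim
  between \<open>b\<close> and \<open>b + 1\<close> in both directions, so induction from 0 also
  reaches the negative integers.\<close>

lemma prime_dvd_int_power_diff:
  assumes "prime q"
  shows "int q dvd a ^ q - a"
proof -
  have add: "int q dvd (b + c) ^ q - (b ^ q + c ^ q)" for b c :: int
    using prime_dvd_add_power_diff[OF assms, of b c] by simp
  have q: "q > 0" using assms by (simp add: prime_gt_0_nat)
  have step: "int q dvd (b + 1) ^ q - (b + 1) \<longleftrightarrow> int q dvd b ^ q - b" for b :: int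
  proof -
    have "(b + 1) ^ q - (b + 1) = ((b + 1) ^ q - (b ^ q + 1 ^ q)) + (b ^ q - b)" by simp
    then show ?thesis using add[of b 1] by (metis dvd_add_right_iff)
  qed
  show ?thesis
  proof (induction a rule: int_induct[where k = 0])
    case base
    then show ?case using q by (simp add: zero_power)
  next
    case (step1 i)
    then show ?case using step[of i] by blast
  next
    case (step2 i)
    then show ?case using step[of "i - 1"] by simp
  qed
qed

text \<open>Frobenius modulo \<open>q\<close>: taking \<open>q\<close>-th powers is additive and, by
  Fermat, fixes the integer coefficients, so its only effect is to substitute \<open>X ^ q\<close>
  for \<open>X\<close>.\<close>

lemma prime_dvd_pcompose_monom_diff:
  fixes h :: "int poly"
  assumes "prime q"
  shows "of_nat q dvd pcompose h (monom 1 q) - h ^ q"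
proof (induction h)
  case 0
  then show ?case using assms by (simp add: prime_gt_0_nat zero_power)
next
  case (pCons a p)
  have split: "pCons a p = [:a:] + monom 1 1 * p"
    by (simp add: monom_Suc monom_0)
  have 1: "of_nat q dvd (pCons a p) ^ q - ([:a:] ^ q + (monom 1 1 * p) ^ q)"
    unfolding split by (rule prime_dvd_add_power_diff[OF assms])
  obtain d where "a ^ q - a = int q * d"
    using prime_dvd_int_power_diff[OF assms, of a] by (elim dvdE)
  then have "[:a:] ^ q - [:a:] = of_nat q * [:d:]"
    by (simp add: poly_const_pow of_nat_poly)
  then have 2: "of_nat q dvd [:a:] ^ q - [:a:]" by (rule dvdI)
  have 3: "of_nat q dvd monom 1 q * (pcompose p (monom 1 q) - p ^ q)"
    using pCons(2) by (rule dvd_mult)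
  have "pcompose (pCons a p) (monom 1 q) - pCons a p ^ q
      = monom 1 q * (pcompose p (monom 1 q) - p ^ q)
        - ([:a:] ^ q - [:a:]) - ((pCons a p) ^ q - ([:a:] ^ q + (monom 1 1 * p) ^ q))"
    by (simp add: pcompose_pCons power_mult_distrib monom_power algebra_simps)
  then show ?case using 1 2 3 by (simp only: dvd_diff)
qed

text \<open>Take the primitive part of an annihilating polynomial of least degree. Pseudo-division
  by it leaves remainder 0, so it divides every annihilating \<open>h\<close> up to a constant
  \<open>c\<close>; by Gauss's lemma on contents, \<open>c\<close> divides the quotient and can be
  cancelled.\<close>

lemma minimal_int_poly:
  assumes "P \<noteq> 0" "ipoly_eval P z = 0"
  obtains f where "f \<noteq> 0" "ipoly_eval f z = 0" "\<And>h. ipoly_eval h z = 0 \<Longrightarrow> f dvd h"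
    "\<And>h. ipoly_eval h z = 0 \<Longrightarrow> degree h < degree f \<Longrightarrow> h = 0"
proof -
  obtain g where g: "g \<noteq> 0" "ipoly_eval g z = 0"
    and min: "\<And>h. h \<noteq> 0 \<and> ipoly_eval h z = 0 \<Longrightarrow> degree g \<le> degree h"
    using ex_has_least_nat[of "\<lambda>g. g \<noteq> 0 \<and> ipoly_eval g z = 0" P degree] assms by blast
  define f where "f = primitive_part g"
  have gf: "g = smult (content g) f" by (simp add: f_def)
  have f0: "f \<noteq> 0" using g by (simp add: f_def)
  have cg: "content g \<noteq> 0" using g by simp
  have fz: "ipoly_eval f z = 0"
    using g cg by (subst (asm) (2) gf) simp
  have deg: "degree f = degree g" using cg by (subst gf) simp
  have cf: "content f = 1" using g by (simp add: f_def)
  have m: "h = 0" if "ipoly_eval h z = 0" "degree h < degree f" for h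
    using min[of h] that deg by force
  have "f dvd h" if h: "ipoly_eval h z = 0" for h
  proof -
    obtain s r where qr: "pseudo_divmod h f = (s, r)" by fastforce
    define c where "c = coeff f (degree f) ^ (Suc (degree h) - degree f)"
    from pseudo_divmod[OF f0 qr] have 1: "smult c h = f * s + r"
      and 2: "r = 0 \<or> degree r < degree f" by (auto simp: c_def)
    have "ipoly_eval (smult c h) z = ipoly_eval (f * s + r) z" by (simp only: 1)
    then have "ipoly_eval r z = 0" using h fz by simp
    then have r: "r = 0" using 2 m by blast
    have "[:c:] dvd f * s" 
      using 1 r by (metis add_0_right dvd_triv_left mult_pCons_left mult_zero_left pCons_0_0)
    then have "c dvd content s"
      by (simp add: const_poly_dvd_iff_dvd_content content_mult cf)
    then have "[:c:] dvd s" by (simp add: const_poly_dvd_iff_dvd_content)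
    then obtain s' where "s = [:c:] * s'" by (elim dvdE)
    then have s': "s = smult c s'" by simp
    have "c \<noteq> 0" using f0 by (simp add: c_def)
    moreover have "smult c h = smult c (f * s')" using 1 r s' by simp
    ultimately have "h = f * s'" by (rule smult_cancel)
    then show ?thesis by simp
  qed
  then show thesis using that f0 fz m by blast
qed


text \<open>
  If \<open>z ^ q\<close> were not a root of \<open>f\<close>, it would be one of the cofactor \<open>h\<close> of \<open>f\<close> in \<open>X ^ N - 1\<close>;
  then \<open>q\<close> divides \<open>h z ^ q\<close> in \<open>\<int>[z]\<close>. Differentiating \<open>X ^ N - 1 = f h\<close> at \<open>z\<close> shows that
  \<open>h z\<close> divides \<open>N\<close> in \<open>\<int>[z]\<close>, which forces \<open>q\<close> to divide \<open>N ^ q\<close>.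
\<close>

lemma root_of_unity_conjugate_prime:
  assumes "z ^ N = 1" "N > 0" "prime q" "\<not> q dvd N" "ipoly_eval P z = 0"
  shows "ipoly_eval P (z ^ q) = 0"
proof -
  have q: "q > 0" using assms by (simp add: prime_gt_0_nat)
  define U :: "int poly" where "U = monom 1 N - 1"
  have "coeff U N = 1" using assms by (simp add: U_def)
  then have "U \<noteq> 0" by auto
  moreover have Uz: "ipoly_eval U w = w ^ N - 1" for w by (simp add: U_def)
  ultimately obtain f where f: "f \<noteq> 0" "ipoly_eval f z = 0"
    and dvd: "\<And>h. ipoly_eval h z = 0 \<Longrightarrow> f dvd h"
    and min: "\<And>h. ipoly_eval h z = 0 \<Longrightarrow> degree h < degree f \<Longrightarrow> h = 0"
    using minimal_int_poly[of U z] assms by auto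
  obtain h where h: "U = f * h" using dvd[of U] Uz assms by auto
  \<comment> \<open>As a factor of the monic \<open>U\<close>, the polynomial \<open>f\<close> has a
    unit as leading coefficient. This makes the multiplier \<open>l\<close> in the pseudo-division
    below invertible over the integers.\<close>
  have "lead_coeff U = 1"
  proof -
    have "degree U = N"
      using assms degree_add_eq_left[of "- 1 :: int poly" "monom 1 N"]
      by (simp add: U_def degree_monom_eq)
    then show ?thesis using \<open>coeff U N = 1\<close> by simp
  qed
  then have lc: "lead_coeff f dvd 1" using h by (metis dvd_triv_left lead_coeff_mult)
  have "ipoly_eval f (z ^ q) = 0"
  proof (rule ccontr)
    assume nz: "ipoly_eval f (z ^ q) \<noteq> 0"
    have "ipoly_eval f (z ^ q) * ipoly_eval h (z ^ q) = (z ^ q) ^ N - 1"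
      using Uz[of "z ^ q"] h by simp
    also have "\<dots> = 0" using assms(1) by (simp add: power_mult[symmetric] mult.commute)
       (simp add: power_mult)
    finally have "ipoly_eval h (z ^ q) = 0" using nz by simp
    then have "ipoly_eval (pcompose h (monom 1 q)) z = 0" by (simp add: ipoly_eval_pcompose)
    moreover obtain b where b: "pcompose h (monom 1 q) - h ^ q = of_nat q * b"
      using prime_dvd_pcompose_monom_diff[OF assms(3), of h] by (elim dvdE)
    ultimately have hz: "ipoly_eval h z ^ q = - of_nat q * ipoly_eval b z"
      using arg_cong[OF b, of "\<lambda>p. ipoly_eval p z"]
      by (simp add: algebra_simps eq_neg_iff_add_eq_0)
    have "pderiv U = f * pderiv h + h * pderiv f" by (simp add: h pderiv_mult)
    then have "ipoly_eval (pderiv U) z = ipoly_eval h z * ipoly_eval (pderiv f) z"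
      using f by simp
    then have "of_nat N * z ^ (N - 1) = ipoly_eval h z * ipoly_eval (pderiv f) z"
      by (simp add: U_def pderiv_diff pderiv_monom)
    then have "of_nat N ^ q * z ^ ((N - 1) * q)
        = - of_nat q * ipoly_eval b z * ipoly_eval (pderiv f) z ^ q"
      by (metis power_mult_distrib power_mult hz)
    \<comment> \<open>The extra factor \<open>z ^ q\<close> completes the exponent to
      \<open>N * q\<close>, where the power of \<open>z\<close> is 1.\<close>
    then have "z ^ q * (of_nat N ^ q * z ^ ((N - 1) * q))
        = z ^ q * (- of_nat q * ipoly_eval b z * ipoly_eval (pderiv f) z ^ q)" by simp
    moreover have "z ^ q * (of_nat N ^ q * z ^ ((N - 1) * q)) = of_nat N ^ q * (z ^ (q + (N - 1) * q))"
      by (simp add: power_add)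
    moreover have "q + (N - 1) * q = N * q" using assms(2) by (cases N) auto
    moreover have "z ^ (N * q) = 1" using assms(1) by (simp add: power_mult)
    ultimately have key: "of_nat N ^ q
        = z ^ q * (- of_nat q * ipoly_eval b z * ipoly_eval (pderiv f) z ^ q)" by simp
    define c where "c = - (monom 1 q * b * pderiv f ^ q)"
    have cz: "of_nat N ^ q = of_nat q * ipoly_eval c z"
      unfolding key by (simp add: c_def algebra_simps)
    have "\<bar>lead_coeff f\<bar> = 1" using lc by simp
    then have uu: "\<exists>e. e * lead_coeff f ^ k = 1" for k
      by (metis lc dvdE mult.commute is_unit_power_iff)
    obtain s r where sr: "pseudo_divmod c f = (s, r)" by fastforce
    define l where "l = coeff f (degree f) ^ (Suc (degree c) - degree f)"
    from pseudo_divmod[OF f(1) sr] have 1: "smult l c = f * s + r"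
      and 2: "r = 0 \<or> degree r < degree f" by (auto simp: l_def)
    obtain e where e: "e * l = 1" using uu unfolding l_def by blast
    have "ipoly_eval (smult l c) z = ipoly_eval (f * s + r) z" by (simp only: 1)
    then have rz: "ipoly_eval r z = of_int l * ipoly_eval c z" using f by simp
    \<comment> \<open>Modulo \<open>f\<close>, the polynomial \<open>c\<close> reduces to
      \<open>e * r\<close>, of degree below that of \<open>f\<close>. Then \<open>V\<close> vanishes
      at \<open>z\<close> and has too small a degree, so it is 0, and its constant coefficient
      exhibits \<open>q\<close> as a divisor of \<open>N ^ q\<close>.\<close>
    define V where "V = [:int N ^ q:] - smult (int q * e) r"
    have "ipoly_eval V z = of_nat N ^ q - of_nat q * (of_int (e * l)) * ipoly_eval c z"
      by (simp add: V_def rz algebra_simps)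
    then have Vz: "ipoly_eval V z = 0" using cz e by simp
    have df: "degree f > 0"
    proof (rule ccontr)
      assume "\<not> degree f > 0"
      then obtain a where "f = [:a:]" by (metis degree_eq_zeroE neq0_conv)
      then show False using f by simp
    qed
    have "degree V < degree f"
      unfolding V_def using df 2
      by (intro degree_diff_less) (auto intro: le_less_trans[OF degree_smult_le])
    then have "V = 0" using Vz min by blast
    then have "coeff V 0 = 0" by simp
    then have "int N ^ q = int q * (e * coeff r 0)" by (simp add: V_def)
    then have "int q dvd int N ^ q" by simp
    then have "q dvd N ^ q" by (metis int_dvd_int_iff of_nat_power)
    then show False using assms prime_dvd_power by blast
  qed
  moreover obtain s where "P = f * s" using dvd[OF assms(5)] by (elim dvdE)
  ultimately show ?thesis by simp
qed

text \<open>Prime factors of \<open>k\<close> are split off one at a time: \<open>z ^ q\<close> is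
  again an \<open>N\<close>-th root of unity, so the induction hypothesis applies to it and the
  cofactor \<open>k'\<close>.\<close>

lemma root_of_unity_conjugate:
  assumes "z ^ N = 1" "N > 0" "coprime k N" "ipoly_eval P z = 0"
  shows "ipoly_eval P (z ^ k) = 0"
  using assms
proof (induction k arbitrary: z rule: less_induct)
  case (less k)
  show ?case
  proof (cases "k = 0 \<or> k = 1")
    \<comment> \<open>For \<open>k = 0\<close>, coprimality forces \<open>N = 1\<close>, hence
      \<open>z = 1\<close>.\<close>
    case True
    then show ?thesis using less.prems by auto
  next
    case False
    then obtain q where q: "prime q" "q dvd k" by (meson prime_factor_nat)
    then obtain k' where k: "k = q * k'" by (elim dvdE)
    have "k' < k" using False q by (cases "k' = 0") (auto simp: k intro: prime_gt_1_nat[unfolded One_nat_def])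
    moreover have "(z ^ q) ^ N = 1"
      using less.prems(1) by (simp add: power_mult[symmetric] mult.commute) (simp add: power_mult)
    moreover have "coprime k' N" using less.prems(3) k by simp
    moreover have "\<not> q dvd N"
      using q less.prems(3) by (meson coprime_common_divisor_nat coprime_common_divisor not_prime_unit)
    then have "ipoly_eval P (z ^ q) = 0"
      using root_of_unity_conjugate_prime q less.prems by blast
    ultimately have "ipoly_eval P ((z ^ q) ^ k') = 0" using less.IH less.prems(2) by blast
    then show ?thesis by (simp add: k power_mult)
  qed
qed

subsection \<open>The Fourier series of the logarithm of the tangent\<close>

text \<open>At \<open>t = 1\<close> this is \<open>ln \<bar>tan (\<theta> / 2)\<bar>\<close>
  whenever \<open>sin \<theta> \<noteq> 0\<close>, since the two moduli are twice those of the sine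
  and cosine of \<open>\<theta> / 2\<close>. The radius \<open>t < 1\<close> makes the Fourier
  series converge absolutely, as in Abel summation.\<close>

definition logratio :: "real \<Rightarrow> real \<Rightarrow> real" where
  "logratio t \<theta> = ln (cmod (1 - of_real t * cis \<theta>)) - ln (cmod (1 + of_real t * cis \<theta>))"

text \<open>Real part of the power series of \<open>ln (1 - w) - ln (1 + w)\<close> at
  \<open>w = t * cis \<theta>\<close>. The factor \<open>1 - (-1) ^ m\<close> removes the even
  indices, including \<open>m = 0\<close>.\<close>

lemma logratio_sums:
  assumes "0 \<le> t" "t < 1"
  shows "(\<lambda>m. - ((1 - (-1) ^ m) / real m * t ^ m * cos (real m * \<theta>))) sums logratio t \<theta>"
proof -
  define w where "w = of_real t * cis \<theta>"
  have w: "cmod w < 1" using assms by (simp add: w_def norm_mult)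
  have nz: "1 - w \<noteq> 0" "1 + w \<noteq> 0"
    using w by (auto simp: add_eq_0_iff)
  have "(\<lambda>m. - ((- (- w)) ^ m) / of_nat m - - ((- w) ^ m) / of_nat m) sums (ln (1 + - w) - ln (1 + w))"
    using w by (intro sums_diff Ln_series') auto
  then have "(\<lambda>m. Re (- (w ^ m) / of_nat m - - ((- w) ^ m) / of_nat m)) sums Re (ln (1 - w) - ln (1 + w))"
    by (intro sums_Re) simp
  moreover have "Re (ln (1 - w) - ln (1 + w)) = logratio t \<theta>"
    using nz by (simp add: logratio_def w_def)
  moreover have "Re (- (w ^ m) / of_nat m - - ((- w) ^ m) / of_nat m)
      = - ((1 - (-1) ^ m) / real m * t ^ m * cos (real m * \<theta>))" for m
  proof -
    have "w ^ m = of_real (t ^ m) * cis (real m * \<theta>)"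
      by (simp add: w_def power_mult_distrib Complex.DeMoivre)
    then have "Re (w ^ m) = t ^ m * cos (real m * \<theta>)"
      by simp
    moreover have "- (w ^ m) / of_nat m - - ((- w) ^ m) / of_nat m
        = of_real (- ((1 - (-1) ^ m) / real m)) * w ^ m"
      by (subst power_minus) (simp add: field_simps diff_divide_distrib)
    ultimately show ?thesis by (simp del: of_real_minus of_real_divide of_real_diff)
  qed
  ultimately show ?thesis by simp
qed

text \<open>Closed form of the cosine sum over the odd residues modulo \<open>4 * n\<close>: all
  terms are 1 if \<open>4 * n\<close> divides \<open>l\<close>, all are -1 if \<open>l\<close> is
  \<open>2 * n\<close> modulo \<open>4 * n\<close>, and otherwise they cancel.\<close>

definition odd_cos_sum :: "nat \<Rightarrow> int \<Rightarrow> real" where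
  "odd_cos_sum n l = 2 * real n * (of_bool (4 * int n dvd l) - of_bool (4 * int n dvd l - 2 * int n))"

lemma sum_cos_odd_multiples:
  assumes "n > 0"
  shows "(\<Sum>j<2 * n. cos (pi * real (2 * j + 1) * of_int l / (2 * real n))) = odd_cos_sum n l"
proof (cases "2 * int n dvd l")
  case True
  then obtain q where q: "l = 2 * int n * q" by (elim dvdE)
  have "cos (pi * real (2 * j + 1) * of_int l / (2 * real n)) = (if even q then 1 else - 1)" for j
  proof -
    have "pi * real (2 * j + 1) * of_int l / (2 * real n) = pi * of_int (int (2 * j + 1) * q)"
      using assms by (simp add: q)
    then show ?thesis by (simp only: cos_npi_int) simp
  qed
  moreover have "4 * int n dvd l \<longleftrightarrow> even q"
  proof -
    have "4 * int n dvd l \<longleftrightarrow> 2 * int n * 2 dvd 2 * int n * q" by (simp add: q mult.commute)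
    then show ?thesis using assms by (subst (asm) dvd_mult_cancel_left) simp
  qed
  moreover have "4 * int n dvd l - 2 * int n \<longleftrightarrow> odd q"
  proof -
    have "4 * int n dvd l - 2 * int n \<longleftrightarrow> 2 * int n * 2 dvd 2 * int n * (q - 1)"
      by (simp add: q algebra_simps)
    then show ?thesis using assms by (subst (asm) dvd_mult_cancel_left) simp
  qed
  ultimately show ?thesis by (simp add: odd_cos_sum_def)
next
  case False
  define \<alpha> where "\<alpha> = pi * of_int l / (2 * real n)"
  have "sin \<alpha> \<noteq> 0"
  proof
    assume "sin \<alpha> = 0"
    then obtain i where "\<alpha> = of_int i * pi" by (auto simp: sin_zero_iff_int2)
    then have "(of_int l :: real) = of_int (2 * int n * i)"
      using assms by (simp add: \<alpha>_def field_simps)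
    then have "l = 2 * int n * i" by (simp only: of_int_eq_iff)
    then show False using False by simp
  qed
  \<comment> \<open>Telescoping: multiplication by \<open>2 * sin \<alpha>\<close> turns each cosine
    into a difference of sines at consecutive even multiples of \<open>\<alpha>\<close>.\<close>
  have "2 * sin \<alpha> * (\<Sum>j<k. cos (real (2 * j + 1) * \<alpha>)) = sin (2 * real k * \<alpha>)" for k
  proof (induction k)
    case (Suc k)
    have "2 * sin \<alpha> * cos (real (2 * k + 1) * \<alpha>) = sin (2 * real (Suc k) * \<alpha>) - sin (2 * real k * \<alpha>)"
    proof -
      have "(2 * real (Suc k) * \<alpha> + 2 * real k * \<alpha>) / 2 = real (2 * k + 1) * \<alpha>"
        "(2 * real (Suc k) * \<alpha> - 2 * real k * \<alpha>) / 2 = \<alpha>"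
        by (simp_all add: field_simps)
      then show ?thesis
        using sin_diff_sin[of "2 * real (Suc k) * \<alpha>" "2 * real k * \<alpha>"] by (simp only:)
    qed
    then show ?case using Suc by (simp add: distrib_left)
  qed simp
  from this[of "2 * n"] have "2 * sin \<alpha> * (\<Sum>j<2 * n. cos (real (2 * j + 1) * \<alpha>)) = sin (4 * real n * \<alpha>)"
    by (simp add: mult.assoc)
  also have "4 * real n * \<alpha> = of_int (2 * l) * pi" using assms by (simp add: \<alpha>_def)
  also have "sin \<dots> = 0" unfolding sin_zero_iff_int2 by blast
  finally have "(\<Sum>j<2 * n. cos (real (2 * j + 1) * \<alpha>)) = 0" using \<open>sin \<alpha> \<noteq> 0\<close> by simp
  moreover have "\<not> 4 * int n dvd l" "\<not> 4 * int n dvd l - 2 * int n"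
  proof -
    have d: "2 * int n dvd 4 * int n" by (rule dvdI[of _ _ 2]) simp
    show "\<not> 4 * int n dvd l" using False d dvd_trans by blast
    show "\<not> 4 * int n dvd l - 2 * int n"
      using False d by (metis dvd_trans dvd_diff_commute dvd_diff_right_iff dvd_refl)
  qed
  ultimately show ?thesis
    by (simp add: odd_cos_sum_def \<alpha>_def mult_ac)
qed

text \<open>
  The terms of the series, in order of their indices \<open>r < p \<le> q < T - r < T + r < \<dots>\<close>, carry the signs
  \<open>+ - - + + - - + + \<dots>\<close>.
\<close>

lemma alternating_block_sums:
  fixes g :: "nat \<Rightarrow> real"
  assumes g0: "\<And>i. 0 \<le> g i" and dec: "\<And>i j. 0 < i \<Longrightarrow> i \<le> j \<Longrightarrow> g j \<le> g i"
    and r: "0 < r" "r < p" "p \<le> q" "q < T - r"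
    and S: "(\<lambda>m. (of_bool (m mod T = r) + of_bool (m mod T = T - r)
        - of_bool (m mod T = p) - of_bool (m mod T = q)) * g m) sums S"
  shows "g r - g p - g q \<le> S" "S \<le> g r"
proof -
  let ?f = "\<lambda>m. (of_bool (m mod T = r) + of_bool (m mod T = T - r)
        - of_bool (m mod T = p) - of_bool (m mod T = q)) * g m"
  \<comment> \<open>The terms of the \<open>l\<close>-th period of length \<open>T\<close>.\<close>
  define B where "B l = g (l * T + r) + g (l * T + T - r) - g (l * T + p) - g (l * T + q)" for l
  have T: "T > 0" using r by simp
  have ind: "(\<Sum>j<T. of_bool (j = s) * g (l * T + j)) = g (l * T + s)" if "s < T" for s l
    using that by (simp add: of_bool_def if_distrib[of "\<lambda>x. x * _"] cong: if_cong)
  have "sum ?f {l * T..<l * T + T} = B l" for l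
  proof -
    have "sum ?f {l * T..<l * T + T} = (\<Sum>j<T. ?f (l * T + j))"
      by (rule sum.reindex_bij_witness[of _ "\<lambda>j. l * T + j" "\<lambda>m. m - l * T"]) auto
    also have "\<dots> = (\<Sum>j<T. of_bool (j = r) * g (l * T + j) + of_bool (j = T - r) * g (l * T + j)
        - of_bool (j = p) * g (l * T + j) - of_bool (j = q) * g (l * T + j))"
      by (intro sum.cong) (auto simp: algebra_simps)
    also have "\<dots> = B l"
      using r by (simp add: sum.distrib sum_subtractf ind B_def)
    finally show ?thesis .
  qed
  then have "B sums S" using sums_group[OF S T] by simp
  then have lim: "(\<lambda>L. \<Sum>l<L. B l) \<longlonglongrightarrow> S" by (simp add: sums_def)
  \<comment> \<open>Both inductions carry a reserve: the upper bound holds back the first positive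
    term of the next period, the lower bound keeps the last positive term of the current one. Each
    pays for the negative terms that are paired with it by monotonicity.\<close>
  have up: "(\<Sum>l<L. B l) \<le> g r - g (L * T + r)" for L
  proof (induction L)
    case (Suc L)
    have "g (L * T + T - r) \<le> g (L * T + q)" "g (Suc L * T + r) \<le> g (L * T + p)"
      using r by (auto intro!: dec)
    then show ?case using Suc by (simp add: B_def)
  qed simp
  have lo: "g r - g p - g q + g (Suc L * T - r) \<le> (\<Sum>l<Suc L. B l)" for L
  proof (induction L)
    case 0
    then show ?case using r by (simp add: B_def)
  next
    case (Suc L)
    have "g (Suc L * T + q) \<le> g (Suc L * T + r)" "g (Suc L * T + p) \<le> g (Suc L * T - r)"
      using r by (auto intro!: dec)
    then show ?case using Suc by (simp add: B_def add.commute)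
  qed
  have "(\<Sum>l<L. B l) \<le> g r" for L using up[of L] g0[of "L * T + r"] by linarith
  then show "S \<le> g r" using lim by (intro LIMSEQ_le_const2) auto
  have "g r - g p - g q \<le> (\<Sum>l<L. B l)" if "L \<ge> 1" for L
    using lo[of "L - 1"] g0[of "Suc (L - 1) * T - r"] that by simp
  then show "g r - g p - g q \<le> S" using lim by (intro LIMSEQ_le_const) auto
qed

subsection \<open>Correlation with cosines\<close>

lemma odd_cos_sum_minus [simp]: "odd_cos_sum n (- l) = odd_cos_sum n l"
proof -
  have "4 * int n dvd - l - 2 * int n \<longleftrightarrow> 4 * int n dvd l - 2 * int n"
  proof -
    have "- l - 2 * int n = - (l - 2 * int n) - 4 * int n" by simp
    then show ?thesis by (metis dvd_diff_left_iff dvd_minus_iff dvd_refl)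
  qed
  then show ?thesis by (simp add: odd_cos_sum_def)
qed

lemma odd_cos_sum_odd:
  assumes "odd l"
  shows "odd_cos_sum n l = 0"
proof -
  have "\<not> 4 * int n dvd l" "\<not> 4 * int n dvd l - 2 * int n"
    using assms by (auto dest: dvd_trans[of 2 "4 * int n", rotated])
  then show ?thesis by (simp add: odd_cos_sum_def)
qed

lemma coprime_four_iff: "coprime 4 a \<longleftrightarrow> odd a" for a :: int
proof -
  have "coprime (2 * 2) a \<longleftrightarrow> odd a" unfolding coprime_mult_left_iff by simp
  then show ?thesis by simp
qed

text \<open>Multiplication by the unit \<open>a\<close> modulo \<open>4 * n\<close> preserves the
  class 0, and also the class \<open>2 * n\<close> because \<open>a\<close> is odd. Adding
  \<open>2 * n\<close> exchanges these two classes and so flips the sign.\<close>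

lemma odd_cos_sum_scale:
  assumes "odd a" "coprime a (int n)" "n > 0"
  shows "odd_cos_sum n (a * d + 2 * int n * q) = (if even q then odd_cos_sum n d else - odd_cos_sum n d)"
proof -
  have cop: "coprime a (4 * int n)"
    using assms coprime_four_iff[of a] by (simp add: coprime_commute)
  have a2: "4 * int n dvd 2 * int n * (a - 1)"
  proof -
    obtain c where "a = 2 * c + 1" using assms(1) by (elim oddE)
    then show ?thesis by simp
  qed
  have A: "4 * int n dvd a * e + c \<longleftrightarrow> 4 * int n dvd e" if "4 * int n dvd c" for e c
    using that cop by (simp add: dvd_add_left_iff coprime_commute coprime_dvd_mult_right_iff)
  have B: "4 * int n dvd a * e + c + 2 * int n \<longleftrightarrow> 4 * int n dvd e - 2 * int n"
    if "4 * int n dvd c" for e c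
  proof -
    have "a * e + c + 2 * int n = a * (e - 2 * int n) + (c + 2 * int n * (a - 1) + 4 * int n)"
      by (simp add: algebra_simps)
    then show ?thesis using A[of "c + 2 * int n * (a - 1) + 4 * int n"] a2 that
      by (simp only: dvd_add dvd_refl)
  qed
  show ?thesis
  proof (cases "even q")
    case True
    then obtain k where k: "q = 2 * k" by (elim evenE)
    have e: "a * d + 2 * int n * q = a * d + 4 * int n * k"
      "a * d + 2 * int n * q - 2 * int n = a * d + 4 * int n * (k - 1) + 2 * int n"
      by (simp_all add: k algebra_simps)
    show ?thesis using True unfolding odd_cos_sum_def e(2) unfolding e(1)
      by (simp add: A B)
  next
    case False
    then obtain k where k: "q = 2 * k + 1" by (elim oddE)
    have e: "a * d + 2 * int n * q = a * d + 4 * int n * k + 2 * int n"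
      "a * d + 2 * int n * q - 2 * int n = a * d + 4 * int n * k"
      by (simp_all add: k algebra_simps)
    have "4 * int n dvd a * d + 4 * int n * k + 2 * int n \<longleftrightarrow> 4 * int n dvd d - 2 * int n"
      "4 * int n dvd a * d + 4 * int n * k \<longleftrightarrow> 4 * int n dvd d"
      by (rule B A, simp)+
    then show ?thesis using False unfolding odd_cos_sum_def e(2) unfolding e(1)
      by (simp only: algebra_simps) simp
  qed
qed

lemma mod_eq_iff_int_dvd:
  assumes "s < T"
  shows "m mod T = s \<longleftrightarrow> int T dvd int m - int s"
proof -
  have "m mod T = s \<longleftrightarrow> m mod T = s mod T" using assms by simp
  also have "\<dots> \<longleftrightarrow> int m mod int T = int s mod int T"
    by (metis of_nat_eq_iff of_nat_mod)
  also have "\<dots> \<longleftrightarrow> int T dvd int m - int s" by (rule mod_eq_dvd_iff)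
  finally show ?thesis .
qed

text \<open>
  The sum over \<open>j\<close> below runs over all odd multipliers \<open>k = 2 j + 1\<close> modulo \<open>4 n\<close>. The weights are
  chosen so that they vanish at the multipliers divisible by \<open>n\<close>, which are not coprime to \<open>4 n\<close>
  (lemma \<open>test_weight_eq_0\<close>).
\<close>

definition test_weight :: "nat \<Rightarrow> nat \<Rightarrow> nat \<Rightarrow> real" where
  "test_weight n b j = cos (pi * real (2 * j + 1) * real b / (2 * real n)) - of_bool (even b)"

definition correlation :: "nat \<Rightarrow> nat \<Rightarrow> nat \<Rightarrow> real \<Rightarrow> real" where
  "correlation n b a t = (\<Sum>j<2 * n. test_weight n b j * logratio t (pi * real (2 * j + 1) * real a / (2 * real n)))"

text \<open>The product-to-sum formula gives the halved terms; the last term comes from the constant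
  part of the test weight.\<close>

definition spectral_coeff :: "nat \<Rightarrow> nat \<Rightarrow> nat \<Rightarrow> nat \<Rightarrow> real" where
  "spectral_coeff n b a m = (odd_cos_sum n (int (a * m) + int b) + odd_cos_sum n (int (a * m) - int b)) / 2
     - of_bool (even b) * odd_cos_sum n (int (a * m))"

lemma sum_test_weight_cos:
  assumes "n > 0"
  shows "(\<Sum>j<2 * n. test_weight n b j * cos (real m * (pi * real (2 * j + 1) * real a / (2 * real n))))
    = spectral_coeff n b a m"
proof -
  let ?c = "\<lambda>l j. cos (pi * real (2 * j + 1) * of_int l / (2 * real n))"
  have "test_weight n b j * cos (real m * (pi * real (2 * j + 1) * real a / (2 * real n)))
     = (?c (int (a * m) + int b) j + ?c (int (a * m) - int b) j) / 2
       - of_bool (even b) * ?c (int (a * m)) j" for j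
  proof -
    define u where "u = pi * real (2 * j + 1) / (2 * real n)"
    have e: "real m * (pi * real (2 * j + 1) * real a / (2 * real n)) = u * real (a * m)"
      "pi * real (2 * j + 1) * real b / (2 * real n) = u * real b"
      "pi * real (2 * j + 1) * of_int (int (a * m)) / (2 * real n) = u * real (a * m)"
      "pi * real (2 * j + 1) * of_int (int (a * m) + int b) / (2 * real n) = u * real (a * m) + u * real b"
      "pi * real (2 * j + 1) * of_int (int (a * m) - int b) / (2 * real n) = u * real (a * m) - u * real b"
      by (simp_all add: u_def algebra_simps add_divide_distrib diff_divide_distrib)
    show ?thesis unfolding test_weight_def e cos_add cos_diff by (simp add: algebra_simps)
  qed
  then show ?thesis
    by (simp only: sum_subtractf sum.distrib sum_divide_distrib[symmetric] sum_distrib_left[symmetric]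
        sum_cos_odd_multiples[OF assms] spectral_coeff_def)
qed

lemma correlation_sums:
  assumes "n > 0" "0 \<le> t" "t < 1"
  shows "(\<lambda>m. - ((1 - (-1) ^ m) / real m * t ^ m * spectral_coeff n b a m)) sums correlation n b a t"
proof -
  have "(\<lambda>m. \<Sum>j<2 * n. test_weight n b j * - ((1 - (-1) ^ m) / real m * t ^ m *
      cos (real m * (pi * real (2 * j + 1) * real a / (2 * real n))))) sums correlation n b a t"
    unfolding correlation_def by (intro sums_sum sums_mult logratio_sums assms)
  moreover have "(\<Sum>j<2 * n. test_weight n b j * - ((1 - (-1) ^ m) / real m * t ^ m *
      cos (real m * (pi * real (2 * j + 1) * real a / (2 * real n)))))
    = - ((1 - (-1) ^ m) / real m * t ^ m * spectral_coeff n b a m)" for m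
    unfolding sum_test_weight_cos[OF assms(1), symmetric] sum_distrib_left sum_negf[symmetric]
    by (intro sum.cong) auto
  ultimately show ?thesis by simp
qed

section \<open>Residue classes that support the series of the correlation\<close>

lemma spectral_coeff_parity_mismatch:
  assumes "odd m" "odd (a + b)"
  shows "spectral_coeff n b a m = 0"
  using assms by (cases "even b") (auto simp: spectral_coeff_def odd_cos_sum_odd)

text \<open>Replacing \<open>\<delta> * b\<close> by \<open>a * r\<close> modulo
  \<open>2 * n\<close> rewrites the two arguments as \<open>a * (m - r)\<close> and
  \<open>a * (m + r)\<close> up to multiples of \<open>2 * n\<close>; the scaling lemma then removes
  \<open>a\<close> at the price of the sign \<open>s\<close>.\<close>

lemma spectral_coeff_odd:
  assumes "odd n" "odd a" "odd b" "coprime a n" "odd r" "r < n"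
    and "2 * int n dvd int (a * r) - \<delta> * int b" "\<delta> = 1 \<or> \<delta> = - 1"
  obtains s where "s = 1 \<or> s = - 1"
    "\<And>m. spectral_coeff n b a m = s * real n * (of_bool (m mod (4 * n) = r) + of_bool (m mod (4 * n) = 4 * n - r)
        - of_bool (m mod (4 * n) = 2 * n - r) - of_bool (m mod (4 * n) = 2 * n + r))"
proof -
  have n: "n > 0" using assms by (cases n) auto
  from assms(7) obtain q where q: "int (a * r) - \<delta> * int b = 2 * int n * q" by (elim dvdE)
  define s :: real where "s = (if even q then 1 else - 1)"
  have "spectral_coeff n b a m = s * real n * (of_bool (m mod (4 * n) = r) + of_bool (m mod (4 * n) = 4 * n - r)
        - of_bool (m mod (4 * n) = 2 * n - r) - of_bool (m mod (4 * n) = 2 * n + r))" for m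
  proof -
    have "odd_cos_sum n (int (a * m) + int b) + odd_cos_sum n (int (a * m) - int b)
      = odd_cos_sum n (int (a * m) - \<delta> * int b) + odd_cos_sum n (int (a * m) + \<delta> * int b)"
      using assms(8) by auto
    also have "int (a * m) - \<delta> * int b = int a * (int m - int r) + 2 * int n * q"
      using q by (simp add: algebra_simps)
    also have "int (a * m) + \<delta> * int b = int a * (int m + int r) + 2 * int n * (- q)"
      using q by (simp add: algebra_simps)
    also have "odd_cos_sum n (int a * (int m - int r) + 2 * int n * q) = s * odd_cos_sum n (int m - int r)"
      using assms n by (subst odd_cos_sum_scale) (auto simp: s_def)
    also have "odd_cos_sum n (int a * (int m + int r) + 2 * int n * (- q)) = s * odd_cos_sum n (int m + int r)"
      using assms n by (subst odd_cos_sum_scale) (auto simp: s_def)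
    finally have 1: "spectral_coeff n b a m = s * (odd_cos_sum n (int m - int r) + odd_cos_sum n (int m + int r)) / 2"
      using assms by (simp add: spectral_coeff_def algebra_simps)
    have e: "m mod (4 * n) = r \<longleftrightarrow> 4 * int n dvd int m - int r"
      "m mod (4 * n) = 4 * n - r \<longleftrightarrow> 4 * int n dvd int m + int r"
      "m mod (4 * n) = 2 * n - r \<longleftrightarrow> 4 * int n dvd int m + int r - 2 * int n"
      "m mod (4 * n) = 2 * n + r \<longleftrightarrow> 4 * int n dvd int m - int r - 2 * int n"
    proof -
      show "m mod (4 * n) = r \<longleftrightarrow> 4 * int n dvd int m - int r"
        using assms by (subst mod_eq_iff_int_dvd) auto
      have "m mod (4 * n) = 4 * n - r \<longleftrightarrow> 4 * int n dvd int m - (4 * int n - int r)"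
        using assms n by (subst mod_eq_iff_int_dvd) (auto simp: odd_pos)
      also have "int m - (4 * int n - int r) = (int m + int r) - 4 * int n" by simp
      also have "4 * int n dvd \<dots> \<longleftrightarrow> 4 * int n dvd int m + int r"
        by (rule dvd_diff_left_iff) simp
      finally show "m mod (4 * n) = 4 * n - r \<longleftrightarrow> 4 * int n dvd int m + int r" .
      show "m mod (4 * n) = 2 * n - r \<longleftrightarrow> 4 * int n dvd int m + int r - 2 * int n"
        using assms n by (subst mod_eq_iff_int_dvd) (auto simp: algebra_simps)
      show "m mod (4 * n) = 2 * n + r \<longleftrightarrow> 4 * int n dvd int m - int r - 2 * int n"
        using assms n by (subst mod_eq_iff_int_dvd) (auto simp: algebra_simps)
    qed
    show ?thesis unfolding 1 e odd_cos_sum_def by (simp add: algebra_simps)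
  qed
  then show thesis using that[of s] by (auto simp: s_def)
qed

text \<open>On multiples of 4, \<open>odd_cos_sum\<close> only detects divisibility by
  \<open>n\<close>, so no sign arises; as \<open>m\<close>, \<open>r\<close> and \<open>n\<close>
  are odd, congruences modulo \<open>n\<close> lift to \<open>2 * n\<close>. The constant part of
  the weight yields the class of \<open>n\<close> with multiplicity 2, written as two terms to fit
  \<open>alternating_block_sums\<close>.\<close>

lemma spectral_coeff_even:
  assumes "odd n" "4 dvd a" "4 dvd b" "coprime a n" "odd r" "r < n" "odd m"
    and "2 * int n dvd int (a * r) - \<delta> * int b" "\<delta> = 1 \<or> \<delta> = - 1"
  shows "spectral_coeff n b a m = real n * (of_bool (m mod (2 * n) = r) + of_bool (m mod (2 * n) = 2 * n - r)
        - of_bool (m mod (2 * n) = n) - of_bool (m mod (2 * n) = n))"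
proof -
  have n: "n > 0" using assms by (cases n) auto
  have cop: "coprime 4 (int n)" using assms(1) by (simp add: coprime_four_iff)
  have cop2: "coprime 2 (int n)" using assms(1) by simp
  have orth4: "odd_cos_sum n l = 2 * real n * of_bool (int n dvd l)" if "4 dvd l" for l
  proof -
    have "4 * int n dvd l \<longleftrightarrow> int n dvd l"
      using that cop by (metis divides_mult dvd_mult_right)
    moreover have "\<not> 4 * int n dvd l - 2 * int n"
    proof
      assume "4 * int n dvd l - 2 * int n"
      then have "4 dvd l - 2 * int n" by (metis dvd_mult_left)
      then have "4 dvd 2 * int n" using that by (metis dvd_diff_right_iff)
      then show False using assms(1) by presburger
    qed
    ultimately show ?thesis by (simp add: odd_cos_sum_def)
  qed
  have a4: "4 dvd int a" "4 dvd int b"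
    using assms by (metis int_dvd_int_iff of_nat_numeral)+
  have nd: "int n dvd int (a * r) - \<delta> * int b" using assms(8) by (metis dvd_mult_right)
  have odd_red: "int n dvd c \<longleftrightarrow> 2 * int n dvd c" if "even c" for c
    using that cop2 by (metis divides_mult dvd_mult_right)
  have cop_a: "int n dvd int a * c \<longleftrightarrow> int n dvd c" for c
    using assms(4) by (simp add: coprime_commute coprime_dvd_mult_right_iff)
  have "odd_cos_sum n (int (a * m) + int b) + odd_cos_sum n (int (a * m) - int b)
      = odd_cos_sum n (int (a * m) - \<delta> * int b) + odd_cos_sum n (int (a * m) + \<delta> * int b)"
    using assms(9) by auto
  also have "odd_cos_sum n (int (a * m) - \<delta> * int b) = 2 * real n * of_bool (2 * int n dvd int m - int r)"
  proof -
    have "int (a * m) - \<delta> * int b = int a * (int m - int r) + (int (a * r) - \<delta> * int b)"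
      by (simp add: algebra_simps)
    then have "int n dvd int (a * m) - \<delta> * int b \<longleftrightarrow> int n dvd int m - int r"
      using nd cop_a by (metis dvd_add_left_iff)
    also have "\<dots> \<longleftrightarrow> 2 * int n dvd int m - int r"
      using assms by (intro odd_red) simp
    finally show ?thesis using a4 by (subst orth4) simp_all
  qed
  also have "odd_cos_sum n (int (a * m) + \<delta> * int b) = 2 * real n * of_bool (2 * int n dvd int m + int r)"
  proof -
    have "int (a * m) + \<delta> * int b = int a * (int m + int r) - (int (a * r) - \<delta> * int b)"
      by (simp add: algebra_simps)
    then have "int n dvd int (a * m) + \<delta> * int b \<longleftrightarrow> int n dvd int m + int r"
      using nd cop_a by (metis dvd_diff_left_iff)
    also have "\<dots> \<longleftrightarrow> 2 * int n dvd int m + int r"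
      using assms by (intro odd_red) simp
    finally show ?thesis using a4 by (subst orth4) simp_all
  qed
  finally have 1: "odd_cos_sum n (int (a * m) + int b) + odd_cos_sum n (int (a * m) - int b) =
    2 * real n * of_bool (2 * int n dvd int m - int r) + 2 * real n * of_bool (2 * int n dvd int m + int r)" .
  have 2: "odd_cos_sum n (int (a * m)) = 2 * real n * of_bool (2 * int n dvd int m - int n)"
  proof -
    have "int n dvd int (a * m) \<longleftrightarrow> int n dvd int m - int n"
      using cop_a[of "int m"] by (simp add: dvd_diff_left_iff)
    also have "\<dots> \<longleftrightarrow> 2 * int n dvd int m - int n"
      using assms by (intro odd_red) simp
    finally show ?thesis using a4 by (subst orth4) simp_all
  qed
  have e: "m mod (2 * n) = r \<longleftrightarrow> 2 * int n dvd int m - int r"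
    "m mod (2 * n) = 2 * n - r \<longleftrightarrow> 2 * int n dvd int m + int r"
    "m mod (2 * n) = n \<longleftrightarrow> 2 * int n dvd int m - int n"
  proof -
    show "m mod (2 * n) = r \<longleftrightarrow> 2 * int n dvd int m - int r"
      using assms by (subst mod_eq_iff_int_dvd) auto
    show "m mod (2 * n) = n \<longleftrightarrow> 2 * int n dvd int m - int n"
      using n by (subst mod_eq_iff_int_dvd) auto
    have "m mod (2 * n) = 2 * n - r \<longleftrightarrow> 2 * int n dvd int m - (2 * int n - int r)"
      using assms n by (subst mod_eq_iff_int_dvd) (auto simp: odd_pos)
    also have "int m - (2 * int n - int r) = (int m + int r) - 2 * int n" by simp
    also have "2 * int n dvd \<dots> \<longleftrightarrow> 2 * int n dvd int m + int r"
      by (rule dvd_diff_left_iff) simp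
    finally show "m mod (2 * n) = 2 * n - r \<longleftrightarrow> 2 * int n dvd int m + int r" .
  qed
  have "even b" using assms(3) by (metis dvd_trans even_numeral)
  then show ?thesis unfolding spectral_coeff_def 1 2 e by (simp add: algebra_simps)
qed

lemma correlation_parity_mismatch:
  assumes "n > 0" "0 \<le> t" "t < 1" "odd (a + b)"
  shows "correlation n b a t = 0"
proof -
  have "(\<lambda>m. - ((1 - (-1) ^ m) / real m * t ^ m * spectral_coeff n b a m)) = (\<lambda>m. 0)"
  proof
    fix m
    show "- ((1 - (-1) ^ m) / real m * t ^ m * spectral_coeff n b a m) = 0"
      using spectral_coeff_parity_mismatch[OF _ assms(4), of m n] by (cases "even m") simp_all
  qed
  then show ?thesis using correlation_sums[OF assms(1-3), of b a] by (simp add: sums_iff)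
qed

text \<open>The numerators to be compared are odd or divisible by 4, so two of different type have
  opposite parity.\<close>

definition same_type :: "nat \<Rightarrow> nat \<Rightarrow> bool" where
  "same_type a b \<longleftrightarrow> odd a \<and> odd b \<or> 4 dvd a \<and> 4 dvd b"

text \<open>Brings both types to the shape of \<open>alternating_block_sums\<close>: period
  \<open>4 * n\<close> with \<open>2 * n - r\<close> and \<open>2 * n + r\<close> for odd
  numerators, period \<open>2 * n\<close> with \<open>n\<close> taken twice otherwise. For even
  \<open>m\<close> both sides vanish, the period being even and the residues odd.\<close>

lemma spectral_coeff_same_type:
  assumes "odd n" "same_type a b" "coprime a n" "odd r" "r < n"
    and "2 * int n dvd int (a * r) - \<delta> * int b" "\<delta> = 1 \<or> \<delta> = - 1"
  obtains s p q T where "s = 1 \<or> s = - 1" "n \<le> p" "p \<le> q" "q < T - r"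
    "\<And>m. (1 - (-1) ^ m) * spectral_coeff n b a m = 2 * real n * s * (of_bool (m mod T = r) + of_bool (m mod T = T - r)
        - of_bool (m mod T = p) - of_bool (m mod T = q))"
proof (cases "odd a")
  case True
  then have "odd b" using assms(2) by (auto simp: same_type_def elim!: dvdE)
  obtain s where s: "s = 1 \<or> s = - 1"
    "\<And>m. spectral_coeff n b a m = s * real n * (of_bool (m mod (4 * n) = r) + of_bool (m mod (4 * n) = 4 * n - r)
        - of_bool (m mod (4 * n) = 2 * n - r) - of_bool (m mod (4 * n) = 2 * n + r))"
    using spectral_coeff_odd[OF assms(1) True \<open>odd b\<close> assms(3-7)] by blast
  have "(1 - (-1) ^ m) * spectral_coeff n b a m = 2 * real n * s * (of_bool (m mod (4 * n) = r)
      + of_bool (m mod (4 * n) = 4 * n - r)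
        - of_bool (m mod (4 * n) = 2 * n - r) - of_bool (m mod (4 * n) = 2 * n + r))" for m
  proof (cases "even m")
    case True
    have "even (m mod (4 * n))" using True by (intro dvd_mod) auto
    then have "m mod (4 * n) \<noteq> r" "m mod (4 * n) \<noteq> 4 * n - r" "m mod (4 * n) \<noteq> 2 * n - r"
      "m mod (4 * n) \<noteq> 2 * n + r"
      using assms(4,5) by (auto intro!: notI)
    then show ?thesis using True by simp
  qed (simp add: s(2))
  then show thesis using assms(4,5) s(1) by (intro that[of s "2 * n - r" "2 * n + r" "4 * n"]) auto
next
  case False
  then have ab: "4 dvd a" "4 dvd b" using assms(2) by (auto simp: same_type_def)
  have "(1 - (-1) ^ m) * spectral_coeff n b a m = 2 * real n * 1 * (of_bool (m mod (2 * n) = r)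
      + of_bool (m mod (2 * n) = 2 * n - r)
        - of_bool (m mod (2 * n) = n) - of_bool (m mod (2 * n) = n))" for m
  proof (cases "even m")
    case True
    have "even (m mod (2 * n))" using True by (intro dvd_mod) auto
    then have "m mod (2 * n) \<noteq> r" "m mod (2 * n) \<noteq> 2 * n - r" "m mod (2 * n) \<noteq> n"
      using assms(1,4,5) by (auto intro!: notI)
    then show ?thesis using True by simp
  qed (simp add: spectral_coeff_even[OF assms(1) ab assms(3-5) _ assms(6,7)])
  then show thesis using assms(1,4,5) by (intro that[of 1 n n "2 * n"]) auto
qed

text \<open>At a multiplier \<open>n * c\<close>, with \<open>c\<close> odd, the angle is
  \<open>c * b * pi / 2\<close>: its cosine is 0 for odd \<open>b\<close>, and 1 for
  \<open>b\<close> divisible by 4, where the subtracted constant cancels it.\<close>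

lemma test_weight_eq_0:
  assumes "n > 0" "odd b \<or> 4 dvd b" "n dvd 2 * j + 1"
  shows "test_weight n b j = 0"
proof -
  from assms(3) obtain c where c: "2 * j + 1 = n * c" by (elim dvdE)
  then have "odd c" by (metis even_mult_iff even_plus_one_iff dvd_triv_left)
  have e: "pi * real (2 * j + 1) * real b / (2 * real n) = real (c * b) * (pi / 2)"
    using assms(1) by (simp only: c) simp
  show ?thesis
  proof (cases "even b")
    case True
    then have "4 dvd b" using assms(2) by simp
    then obtain d where d: "b = 4 * d" by (elim dvdE)
    have "real (c * b) * (pi / 2) = real (2 * (c * d)) * pi" by (simp add: d)
    then show ?thesis using True by (simp only: test_weight_def e cos_npi) simp
  next
    case False
    then have "odd (c * b)" using \<open>odd c\<close> by simp
    then have "cos (real (c * b) * (pi / 2)) = 0" unfolding cos_zero_iff by blast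
    then show ?thesis using False by (simp only: test_weight_def e) simp
  qed
qed

section \<open>Passage to the limit \<open>t = 1\<close>\<close>

lemma sin_angle_nonzero:
  assumes "n > 0" "\<not> n dvd m"
  shows "sin (pi * real m / (2 * real n)) \<noteq> 0"
proof
  assume "sin (pi * real m / (2 * real n)) = 0"
  then obtain i where "pi * real m / (2 * real n) = of_int i * pi" by (auto simp: sin_zero_iff_int2)
  then have "of_int (int m) = (of_int (2 * int n * i) :: real)"
    using assms(1) by (simp add: field_simps)
  then have "int m = 2 * int n * i" by (simp only: of_int_eq_iff)
  then have "int n dvd int m" by simp
  then show False using assms(2) by (simp only: int_dvd_int_iff)
qed

text \<open>The logarithms can be singular at \<open>t = 1\<close> only for multipliers divisible by
  \<open>n\<close>, and there the weight is 0.\<close>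

lemma tendsto_correlation:
  assumes "prime n" "odd b \<or> 4 dvd b" "coprime a n"
  shows "(correlation n b a \<longlongrightarrow> correlation n b a 1) (at_left 1)"
proof -
  have n: "n > 0" using assms by (simp add: prime_gt_0_nat)
  have "((\<lambda>t. test_weight n b j * logratio t (pi * real (2 * j + 1) * real a / (2 * real n))) \<longlongrightarrow>
      test_weight n b j * logratio 1 (pi * real (2 * j + 1) * real a / (2 * real n))) (at_left 1)" for j
  proof (cases "n dvd 2 * j + 1")
    case True
    then show ?thesis using test_weight_eq_0[OF n assms(2)] by simp
  next
    case False
    define \<theta> where "\<theta> = pi * real (2 * j + 1) * real a / (2 * real n)"
    have "\<not> n dvd (2 * j + 1) * a"
      using False assms(3) by (metis coprime_commute coprime_dvd_mult_left_iff)
    then have "sin \<theta> \<noteq> 0"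
      using sin_angle_nonzero[OF n, of "(2 * j + 1) * a"] by (simp only: \<theta>_def of_nat_mult mult.assoc) simp
    then have nz: "1 - cis \<theta> \<noteq> 0" "1 + cis \<theta> \<noteq> 0" by (auto simp: complex_eq_iff)
    have "((\<lambda>t. logratio t \<theta>) \<longlongrightarrow> logratio 1 \<theta>) (at_left 1)"
      unfolding logratio_def using nz by (auto intro!: tendsto_eq_intros)
    then show ?thesis unfolding \<theta>_def by (intro tendsto_mult tendsto_const)
  qed
  then show ?thesis unfolding correlation_def[abs_def] by (intro tendsto_sum)
qed

text \<open>For \<open>t < 1\<close>, \<open>alternating_block_sums\<close> with
  \<open>g m = t ^ m / m\<close> bounds the normalised correlation, and the bounds survive the
  limit. As \<open>p\<close> and \<open>q\<close> are at least \<open>n\<close>, the two subtracted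
  terms cost at most \<open>2 / n\<close>.\<close>

lemma correlation_bounds:
  assumes "prime n" "odd n" "same_type a b" "coprime a n" "odd r" "r < n"
    and "2 * int n dvd int (a * r) - \<delta> * int b" "\<delta> = 1 \<or> \<delta> = - 1"
  shows "\<bar>correlation n b a 1\<bar> \<le> 2 * real n * (1 / real r)"
    "2 * real n * (1 / real r - 2 / real n) \<le> \<bar>correlation n b a 1\<bar>"
proof -
  have n: "n > 0" using assms by (simp add: prime_gt_0_nat)
  have r: "r > 0" using assms(5) by (cases r) auto
  obtain s p q T where spq: "s = 1 \<or> s = - 1" "n \<le> p" "p \<le> q" "q < T - r"
    and sp: "\<And>m. (1 - (-1) ^ m) * spectral_coeff n b a m = 2 * real n * s * (of_bool (m mod T = r) + of_bool (m mod T = T - r)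
        - of_bool (m mod T = p) - of_bool (m mod T = q))"
    using spectral_coeff_same_type[OF assms(2-8)] by metis
  define S where "S t = - s * correlation n b a t / (2 * real n)" for t
  have ss: "s * s = 1" using spq by auto
  have bd: "t ^ r / real r - t ^ p / real p - t ^ q / real q \<le> S t \<and> S t \<le> t ^ r / real r"
    if t: "0 \<le> t" "t < 1" for t
  proof -
    have "(\<lambda>m. - s / (2 * real n) * - ((1 - (-1) ^ m) / real m * t ^ m * spectral_coeff n b a m)) sums
      (- s / (2 * real n) * correlation n b a t)"
      by (intro sums_mult correlation_sums n t)
    moreover have "- s / (2 * real n) * - ((1 - (-1) ^ m) / real m * t ^ m * spectral_coeff n b a m)
      = (of_bool (m mod T = r) + of_bool (m mod T = T - r)
        - of_bool (m mod T = p) - of_bool (m mod T = q)) * (t ^ m / real m)" for m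
    proof -
      have "- s / (2 * real n) * - ((1 - (-1) ^ m) / real m * t ^ m * spectral_coeff n b a m)
        = s / (2 * real n) * ((1 - (-1) ^ m) * spectral_coeff n b a m) * (t ^ m / real m)" by simp
      also have "\<dots> = (s * s) * (of_bool (m mod T = r) + of_bool (m mod T = T - r)
        - of_bool (m mod T = p) - of_bool (m mod T = q)) * (t ^ m / real m)"
        unfolding sp using n by simp
      finally show ?thesis by (simp only: ss mult_1_left)
    qed
    ultimately have "(\<lambda>m. (of_bool (m mod T = r) + of_bool (m mod T = T - r)
        - of_bool (m mod T = p) - of_bool (m mod T = q)) * (t ^ m / real m)) sums S t"
      by (simp only: S_def times_divide_eq_left)
    moreover have "t ^ j / real j \<le> t ^ i / real i" if "0 < i" "i \<le> j" for i j
      using that t by (intro frac_le power_decreasing) auto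
    ultimately show ?thesis
      using alternating_block_sums[of "\<lambda>m. t ^ m / real m" r p q T "S t"] spq r assms(6) t by auto
  qed
  have "odd b \<or> 4 dvd b" using assms(3) by (auto simp: same_type_def)
  then have lim: "(S \<longlongrightarrow> S 1) (at_left 1)"
    unfolding S_def[abs_def] using tendsto_correlation[OF assms(1) _ assms(4), of b] n by (intro tendsto_intros) auto
  have ev: "\<forall>\<^sub>F t :: real in at_left 1. 0 \<le> t \<and> t < 1"
    by (rule eventually_at_leftI[of 0]) auto
  have lim_pow: "((\<lambda>t. t ^ k / real k) \<longlongrightarrow> 1 ^ k / real k) (at_left 1)" for k
    unfolding divide_inverse by (intro tendsto_mult tendsto_power tendsto_ident_at tendsto_const)
  have "S 1 \<le> 1 ^ r / real r"
    by (rule tendsto_le[OF _ lim_pow lim]) (auto intro!: eventually_mono[OF ev] dest: bd)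
  moreover have "1 ^ r / real r - 1 ^ p / real p - 1 ^ q / real q \<le> S 1"
    by (rule tendsto_le[OF _ lim tendsto_diff[OF tendsto_diff[OF lim_pow lim_pow] lim_pow]])
       (auto intro!: eventually_mono[OF ev] dest: bd)
  moreover have "1 / real p \<le> 1 / real n" "1 / real q \<le> 1 / real n" "1 / real n \<le> 1 / real r"
    using spq n r assms(6) by (auto intro!: divide_left_mono)
  \<comment> \<open>Since \<open>r < n\<close>, the lower bound is at least
    \<open>- (1 / r)\<close>, which turns the upper bound into one for the absolute value.\<close>
  ultimately have "1 / real r - 2 / real n \<le> S 1" "\<bar>S 1\<bar> \<le> 1 / real r" by auto
  moreover have "\<bar>correlation n b a 1\<bar> = 2 * real n * \<bar>S 1\<bar>"
    using spq(1) n by (auto simp: S_def abs_mult)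
  moreover have "2 * real n * \<bar>S 1\<bar> \<le> 2 * real n * (1 / real r)"
    by (rule mult_left_mono) (use \<open>\<bar>S 1\<bar> \<le> 1 / real r\<close> in simp_all)
  moreover have "2 * real n * (1 / real r - 2 / real n) \<le> 2 * real n * \<bar>S 1\<bar>"
    by (rule mult_left_mono) (use \<open>1 / real r - 2 / real n \<le> S 1\<close> in simp_all)
  ultimately show "\<bar>correlation n b a 1\<bar> \<le> 2 * real n * (1 / real r)"
    "2 * real n * (1 / real r - 2 / real n) \<le> \<bar>correlation n b a 1\<bar>"
    by simp_all
qed

lemma correlation_at_1_parity_mismatch:
  assumes "prime n" "odd b \<or> 4 dvd b" "coprime a n" "odd (a + b)"
  shows "correlation n b a 1 = 0"
proof -
  have "\<forall>\<^sub>F t :: real in at_left 1. 0 = correlation n b a t"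
    by (rule eventually_at_leftI[of 0])
       (use assms in \<open>auto simp: correlation_parity_mismatch prime_gt_0_nat\<close>)
  then have "(correlation n b a \<longlongrightarrow> 0) (at_left 1)"
    by (rule Lim_transform_eventually[OF tendsto_const])
  then show ?thesis
    using tendsto_correlation[OF assms(1-3)] tendsto_unique[OF trivial_limit_at_left_real] by blast
qed

subsection \<open>Independence of the logarithms\<close>

lemma sum_odd_reciprocals_less:
  assumes "odd n" "n \<ge> 3" "finite R" "card R \<le> 4" "\<And>r. r \<in> R \<Longrightarrow> odd r \<and> 3 \<le> r \<and> r < n"
  shows "(\<Sum>r\<in>R. 1 / real r) < 1 - 2 / real n"
proof (cases "n \<ge> 11")
  case True
  let ?D = "{3, 5, 7, 9} :: nat set"
  have *: "r \<ge> 9" if "r \<in> R - ?D" for r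
  proof -
    have "odd r" "3 \<le> r" "r \<notin> ?D" using that assms(5) by auto
    then show ?thesis by (auto elim!: oddE)
  qed
  \<comment> \<open>Subtracting 1/9 from each summand makes those outside \<open>?D\<close>
    nonpositive and those inside nonnegative, so the set 3, 5, 7, 9 is the worst case. For
    \<open>n < 11\<close> there are at most three admissible values of \<open>r\<close>.\<close>
  have "(\<Sum>r\<in>R. 1 / real r) - real (card R) / 9 = (\<Sum>r\<in>R. 1 / real r - 1 / 9)"
    by (simp add: sum_subtractf)
  also have "\<dots> = (\<Sum>r\<in>R \<inter> ?D. 1 / real r - 1 / 9) + (\<Sum>r\<in>R - ?D. 1 / real r - 1 / 9)"
    by (rule sum.Int_Diff) fact
  also have "(\<Sum>r\<in>R - ?D. 1 / real r - 1 / 9) \<le> 0"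
    using * by (intro sum_nonpos) (auto simp: divide_simps simp del: Diff_insert)
  also have "(\<Sum>r\<in>R \<inter> ?D. 1 / real r - 1 / 9) \<le> (\<Sum>r\<in>?D. 1 / real r - 1 / 9)"
    by (intro sum_mono2) auto
  finally have "(\<Sum>r\<in>R. 1 / real r) \<le> 4 / 9 + (\<Sum>r\<in>?D. 1 / real r - 1 / 9)"
    using assms(4) by simp
  also have "\<dots> < 1 - 2 / 11" by simp
  also have "\<dots> \<le> 1 - 2 / real n" using True by (simp add: field_simps)
  finally show ?thesis .
next
  case False
  have D: "(\<Sum>r\<in>R. 1 / real r) \<le> (\<Sum>r\<in>D. 1 / real r)"
    if "finite D" "\<And>r. odd r \<Longrightarrow> 3 \<le> r \<Longrightarrow> r < n \<Longrightarrow> r \<in> D" for D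
    using that assms(5) by (intro sum_mono2) auto
  have "n = 3 \<or> n = 5 \<or> n = 7 \<or> n = 9" using assms(1,2) False by presburger
  then show ?thesis
  proof (elim disjE)
    assume n: "n = 3"
    have "(\<Sum>r\<in>R. 1 / real r) \<le> (\<Sum>r\<in>{}. 1 / real r)" by (rule D) (auto simp: n)
    then show ?thesis by (simp add: n)
  next
    assume n: "n = 5"
    have "(\<Sum>r\<in>R. 1 / real r) \<le> (\<Sum>r\<in>{3}. 1 / real r)" by (rule D) (simp, simp add: n, presburger)
    then show ?thesis by (simp add: n)
  next
    assume n: "n = 7"
    have "(\<Sum>r\<in>R. 1 / real r) \<le> (\<Sum>r\<in>{3, 5}. 1 / real r)" by (rule D) (simp, simp add: n, presburger)
    then show ?thesis by (simp add: n)
  next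
    assume n: "n = 9"
    have "(\<Sum>r\<in>R. 1 / real r) \<le> (\<Sum>r\<in>{3, 5, 7}. 1 / real r)" by (rule D) (simp, simp add: n, presburger)
    then show ?thesis by (simp add: n)
  qed
qed

text \<open>
  Every angle in question is \<open>\<pi> a / (4 n)\<close> with \<open>0 < a < 2 n\<close> and \<open>n\<close> not dividing \<open>a\<close>; the
  complementary angle has numerator \<open>2 n - a\<close>. The following predicate picks one numerator
  from each pair \<open>{a, 2 n - a}\<close>.
\<close>

definition canonical :: "nat \<Rightarrow> nat \<Rightarrow> bool" where
  "canonical n a \<longleftrightarrow> \<not> n dvd a \<and> (odd a \<and> a < n \<or> 4 dvd a \<and> a < 2 * n)"

section \<open>The odd ratio between two canonical numerators\<close>

lemma two_times_dvd_int_iff: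
  assumes "odd n" "even c"
  shows "2 * int n dvd c \<longleftrightarrow> int n dvd c"
proof -
  have "coprime 2 (int n)" using assms(1) by simp
  then show ?thesis using assms(2) by (metis divides_mult dvd_mult_right)
qed

text \<open>Solve \<open>a * r0 = b\<close> modulo \<open>n\<close>; if \<open>r0\<close> is even,
  \<open>n - r0\<close> is odd and solves it with the opposite sign. The difference is even, which
  lifts the congruence to \<open>2 * n\<close>.\<close>

lemma canonical_ratio_exists:
  assumes "prime n" "odd n" "canonical n a" "canonical n b" "same_type a b"
  shows "\<exists>r \<delta>. odd r \<and> r < n \<and> (\<delta> = 1 \<or> \<delta> = - 1) \<and> 2 * int n dvd int (a * r) - \<delta> * int b"
proof -
  have n: "n > 0" using assms by (simp add: prime_gt_0_nat)
  have "coprime a n" 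
    using assms(1,3) prime_imp_coprime[of n a] by (simp add: canonical_def coprime_commute)
  then obtain x where "[a * x = 1] (mod n)" using cong_solve_coprime_nat by auto
  then have "[a * x * b = 1 * b] (mod n)" by (rule cong_scalar_right)
  then have 1: "[a * (x * b) = b] (mod n)" by (simp add: mult.assoc)
  define r0 where "r0 = x * b mod n"
  have r0: "r0 < n" using n by (simp add: r0_def)
  have c0: "[a * r0 = b] (mod n)"
    using 1 by (simp add: r0_def cong_def mod_mult_right_eq)
  have "r0 \<noteq> 0"
  proof
    assume "r0 = 0"
    then have "n dvd b" using c0 by (metis cong_dvd_iff dvd_0_right mult_0_right)
    then show False using assms(4) by (simp add: canonical_def)
  qed
  have nd: "int n dvd int (a * r0) - int b"
    using c0 by (simp flip: cong_int_iff add: cong_iff_dvd_diff)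
  have ev: "even (int (a * r) - \<delta> * int b)" if "odd r" "\<delta> = 1 \<or> \<delta> = - 1" for r \<delta>
    using assms(5) that by (auto simp: same_type_def elim!: dvdE[of 4])
  show ?thesis
  proof (cases "odd r0")
    case True
    then have "2 * int n dvd int (a * r0) - 1 * int b"
      using nd ev[of r0 1] assms(2) by (subst two_times_dvd_int_iff) auto
    then show ?thesis using True r0 by blast
  next
    case False
    then have o: "odd (n - r0)" using assms(2) r0 by simp
    have "int (a * (n - r0)) - (- 1) * int b = int a * int n - (int (a * r0) - int b)"
      using r0 by (simp add: of_nat_diff algebra_simps)
    then have "int n dvd int (a * (n - r0)) - (- 1) * int b"
      using nd by (simp only: dvd_diff dvd_triv_right)
    then have "2 * int n dvd int (a * (n - r0)) - (- 1) * int b"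
      using ev[OF o, of "- 1"] assms(2) by (subst two_times_dvd_int_iff) auto
    moreover have "n - r0 < n" using \<open>r0 \<noteq> 0\<close> r0 by simp
    ultimately show ?thesis using o by blast
  qed
qed

text \<open>Cancelling \<open>r\<close> gives \<open>a = a'\<close> or \<open>a = - a'\<close>
  modulo \<open>n\<close>. Parity, or divisibility by 4, together with the range of canonical
  numerators forces equality in the first case and \<open>a + a' = 0\<close> in the second.\<close>

lemma canonical_ratio_inj:
  assumes "prime n" "odd n" "canonical n a" "canonical n a'" "same_type a a'" "odd r" "r < n"
    and "2 * int n dvd int (a * r) - \<delta> * int b" "\<delta> = 1 \<or> \<delta> = - 1"
    and "2 * int n dvd int (a' * r) - \<delta>' * int b" "\<delta>' = 1 \<or> \<delta>' = - 1"
  shows "a = a'"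
proof -
  have "\<exists>\<epsilon>. (\<epsilon> = 1 \<or> \<epsilon> = - 1) \<and> int n dvd int a - \<epsilon> * int a'"
  proof -
    define \<epsilon> where "\<epsilon> = \<delta> * \<delta>'"
    have "int r * (int a - \<epsilon> * int a') = (int (a * r) - \<delta> * int b) - \<epsilon> * (int (a' * r) - \<delta>' * int b)"
      using assms(9,11) by (auto simp: \<epsilon>_def algebra_simps)
    moreover have "int n dvd \<dots>"
      using assms(8,10)[THEN dvd_mult_right] by (rule dvd_diff[OF _ dvd_mult])
    moreover have "coprime (int n) (int r)"
    proof -
      have "r > 0" using assms(6) by (cases r) auto
      then have "\<not> n dvd r" using assms(7) by (auto dest: dvd_imp_le)
      then have "coprime n r" using assms(1) by (rule prime_imp_coprime[rotated])
      then show ?thesis by simp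
    qed
    ultimately have "int n dvd int a - \<epsilon> * int a'" by (metis coprime_dvd_mult_right_iff)
    then show ?thesis using assms(9,11) by (intro exI[of _ \<epsilon>]) (auto simp: \<epsilon>_def)
  qed
  then consider "int n dvd int a - int a'" | "int n dvd int a + int a'" by force
  then show ?thesis
  proof cases
    case 1
    show ?thesis
    proof (cases "odd a")
      case True
      then have "a < n" "a' < n" using assms(3-5) by (auto simp: canonical_def same_type_def elim!: dvdE[of 4])
      then have "\<bar>int a - int a'\<bar> < int n" by auto
      then show ?thesis using 1 by (metis dvd_imp_le_int abs_of_nat eq_iff_diff_eq_0 not_less of_nat_eq_iff)
    next
      case False
      then have lt: "a < 2 * n" "a' < 2 * n" and d: "4 dvd a" "4 dvd a'"
        using assms(3-5) by (auto simp: canonical_def same_type_def)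
      have "2 * int n dvd int a - int a'"
        using 1 d assms(2) by (subst two_times_dvd_int_iff) (auto elim!: dvdE[of 4])
      moreover have "\<bar>int a - int a'\<bar> < 2 * int n" using lt by auto
      ultimately show ?thesis by (metis dvd_imp_le_int abs_mult abs_numeral abs_of_nat eq_iff_diff_eq_0 not_less of_nat_eq_iff)
    qed
  next
    case 2
    then have nd: "n dvd a + a'" by (metis int_dvd_int_iff of_nat_add)
    then obtain k where k: "a + a' = n * k" by (elim dvdE)
    show ?thesis
    proof (cases "odd a")
      case True
      then have "a < n" "a' < n" "odd a'" using assms(3-5) by (auto simp: canonical_def same_type_def elim!: dvdE[of 4])
      then have "n * k < n * 2" "even (n * k)" using True by (auto simp flip: k)
      then have "k < 2" "even k" using assms(2) by simp_all
      then have "k = 0" by presburger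
      then show ?thesis using k by simp
    next
      case False
      then have lt: "a < 2 * n" "a' < 2 * n" and d: "4 dvd a" "4 dvd a'"
        using assms(3-5) by (auto simp: canonical_def same_type_def)
      have "n * k < n * 4" "4 dvd n * k" using lt d by (auto simp flip: k)
      moreover have "coprime 4 (int n)" using assms(2) by (simp add: coprime_four_iff)
      then have "coprime 4 n" by (metis coprime_int_iff of_nat_numeral)
      ultimately have "k < 4" "4 dvd k" by (simp_all add: coprime_dvd_mult_right_iff)
      then have "k = 0" by presburger
      then show ?thesis using k by simp
    qed
  qed
qed

text \<open>Diagonal dominance: in the row of \<open>b\<close>, the correlation of \<open>b\<close>
  with itself exceeds the sum of the absolute values of all the others.\<close>

lemma logratio_independent:
  assumes "prime n" "odd n" "finite V" "card V \<le> 5" "\<And>a. a \<in> V \<Longrightarrow> canonical n a"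
    and rel: "\<And>j. \<not> n dvd 2 * j + 1 \<Longrightarrow>
      (\<Sum>a\<in>V. c a * logratio 1 (pi * real (2 * j + 1) * real a / (2 * real n))) = 0"
    and "a \<in> V"
  shows "c a = 0"
proof (rule ccontr)
  assume "c a \<noteq> 0"
  have n: "n > 0" "n \<ge> 3" using assms(1,2) prime_ge_2_nat[of n] by (auto elim!: oddE)
  define M where "M = Max ((\<lambda>v. \<bar>c v\<bar>) ` V)"
  have "M \<in> (\<lambda>v. \<bar>c v\<bar>) ` V" unfolding M_def using assms by (intro Max_in) auto
  then obtain b where b: "b \<in> V" "M = \<bar>c b\<bar>" by auto
  have M: "\<bar>c v\<bar> \<le> M" if "v \<in> V" for v unfolding M_def using assms(3) that by (intro Max_ge) auto
  have "M > 0" using M[OF assms(7)] \<open>c a \<noteq> 0\<close> by linarith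
  have cb: "canonical n b" using b assms by blast
  have b4: "odd b \<or> 4 dvd b" using cb by (auto simp: canonical_def)
  have cop: "coprime v n" if "v \<in> V" for v
    using assms(1) assms(5)[OF that] prime_imp_coprime[of n v] by (simp add: canonical_def coprime_commute)
  define W where "W = {v \<in> V - {b}. same_type v b}"
  have W: "finite W" "W \<subseteq> V" "W \<subseteq> V - {b}" using assms(3) by (auto simp: W_def)
  have "card W \<le> card (V - {b})" using W assms(3) by (intro card_mono) auto
  then have cardW: "card W \<le> 4" using assms(3,4) b by simp
  have ex: "\<exists>r \<delta>. odd r \<and> r < n \<and> (\<delta> = 1 \<or> \<delta> = - 1) \<and> 2 * int n dvd int (v * r) - \<delta> * int b" if "v \<in> W" for v
    using that assms cb by (intro canonical_ratio_exists) (auto simp: W_def)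
  define \<rho> where "\<rho> v = (SOME r. \<exists>\<delta>. odd r \<and> r < n \<and> (\<delta> = 1 \<or> \<delta> = - 1) \<and>
      2 * int n dvd int (v * r) - \<delta> * int b)" for v
  have \<rho>: "\<exists>\<delta>. odd (\<rho> v) \<and> \<rho> v < n \<and> (\<delta> = 1 \<or> \<delta> = - 1) \<and>
      2 * int n dvd int (v * \<rho> v) - \<delta> * int b" if "v \<in> W" for v
    unfolding \<rho>_def using ex[OF that] by (rule someI_ex)
  have inj: "inj_on \<rho> W"
  proof
    fix v w assume vw: "v \<in> W" "w \<in> W" "\<rho> v = \<rho> w"
    then have "same_type v w" by (auto simp: W_def same_type_def)
    moreover have "canonical n v" "canonical n w" using vw W assms(5) by auto
    ultimately show "v = w" using \<rho>[OF vw(1)] \<rho>[OF vw(2)] vw(3) canonical_ratio_inj[OF assms(1,2)] by metis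
  qed
  \<comment> \<open>The numerator \<open>b\<close> itself has ratio 1, so injectivity excludes this
    value for \<open>v\<close> in \<open>W\<close> and leaves odd ratios of at least 3.\<close>
  have ne1: "\<rho> v \<noteq> 1" if v: "v \<in> W" for v
  proof
    assume e: "\<rho> v = 1"
    have "same_type v b" "canonical n v" using v W assms(5) by (auto simp: W_def)
    moreover obtain \<delta> where "\<delta> = 1 \<or> \<delta> = - 1" "2 * int n dvd int (v * 1) - \<delta> * int b"
      using \<rho>[OF v] e by metis
    ultimately have "v = b"
      using canonical_ratio_inj[OF assms(1,2), of v b 1 \<delta> b 1] cb n by auto
    then show False using v by (simp add: W_def)
  qed
  have bdW: "\<bar>correlation n b v 1\<bar> \<le> 2 * real n * (1 / real (\<rho> v))" if v: "v \<in> W" for v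
  proof -
    obtain \<delta> where "odd (\<rho> v)" "\<rho> v < n" "\<delta> = 1 \<or> \<delta> = - 1"
      "2 * int n dvd int (v * \<rho> v) - \<delta> * int b" using \<rho>[OF v] by metis
    then show ?thesis using v W by (intro correlation_bounds(1)[OF assms(1,2)] cop) (auto simp: W_def)
  qed
  have bdb: "2 * real n * (1 - 2 / real n) \<le> \<bar>correlation n b b 1\<bar>"
    using correlation_bounds(2)[OF assms(1,2), of b b 1 1] cop b n b4 by (simp add: same_type_def)
  have zero: "correlation n b v 1 = 0" if "v \<in> V - {b} - W" for v
  proof (rule correlation_at_1_parity_mismatch[OF assms(1) b4])
    show "coprime v n" using that cop by simp
    have "canonical n v" "\<not> same_type v b" using that assms(5) by (auto simp: W_def)
    then show "odd (v + b)" using cb by (auto simp: canonical_def same_type_def elim!: dvdE[of 4])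
  qed
  \<comment> \<open>After the sums are exchanged every multiplier contributes 0: either
    \<open>n\<close> divides it and the weight vanishes, or the assumed relation applies.\<close>
  have "(\<Sum>v\<in>V. c v * correlation n b v 1)
    = (\<Sum>j<2 * n. test_weight n b j * (\<Sum>v\<in>V. c v * logratio 1 (pi * real (2 * j + 1) * real v / (2 * real n))))"
    unfolding correlation_def sum_distrib_left
    by (subst sum.swap) (simp add: mult_ac)
  also have "\<dots> = 0"
  proof (intro sum.neutral ballI)
    fix j
    show "test_weight n b j * (\<Sum>v\<in>V. c v * logratio 1 (pi * real (2 * j + 1) * real v / (2 * real n))) = 0"
    proof (cases "n dvd 2 * j + 1")
      case True
      then show ?thesis by (simp only: test_weight_eq_0[OF n(1) b4] mult_zero_left)
    next
      case False
      show ?thesis unfolding rel[OF False] by simp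
    qed
  qed
  finally have "(\<Sum>v\<in>V. c v * correlation n b v 1) = 0" .
  moreover have "(\<Sum>v\<in>V. c v * correlation n b v 1) = c b * correlation n b b 1 + (\<Sum>v\<in>V - {b}. c v * correlation n b v 1)"
    using assms(3) b by (simp add: sum.remove)
  moreover have "(\<Sum>v\<in>V - {b}. c v * correlation n b v 1) = (\<Sum>v\<in>W. c v * correlation n b v 1)"
    using W assms(3) zero by (intro sum.mono_neutral_right) auto
  ultimately have "\<bar>c b * correlation n b b 1\<bar> = \<bar>\<Sum>v\<in>W. c v * correlation n b v 1\<bar>" by linarith
  also have "\<dots> \<le> (\<Sum>v\<in>W. \<bar>c v * correlation n b v 1\<bar>)" by (rule sum_abs)
  also have "\<dots> \<le> (\<Sum>v\<in>W. M * (2 * real n * (1 / real (\<rho> v))))"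
  proof (rule sum_mono)
    fix v assume "v \<in> W"
    then show "\<bar>c v * correlation n b v 1\<bar> \<le> M * (2 * real n * (1 / real (\<rho> v)))"
      unfolding abs_mult using W \<open>M > 0\<close> by (intro mult_mono M bdW) auto
  qed
  also have "\<dots> = M * (2 * real n * (\<Sum>v\<in>W. 1 / real (\<rho> v)))"
    by (simp only: sum_distrib_left)
  also have "(\<Sum>v\<in>W. 1 / real (\<rho> v)) = (\<Sum>r\<in>\<rho> ` W. 1 / real r)"
    by (simp add: sum.reindex[OF inj])
  also have "M * (2 * real n * \<dots>) < M * (2 * real n * (1 - 2 / real n))"
  proof -
    have "(\<Sum>r\<in>\<rho> ` W. 1 / real r) < 1 - 2 / real n"
    proof (rule sum_odd_reciprocals_less)
      show "card (\<rho> ` W) \<le> 4" using cardW card_image_le[OF W(1), of \<rho>] by simp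
      fix r assume "r \<in> \<rho> ` W"
      then obtain v where v: "v \<in> W" "r = \<rho> v" by auto
      then have "odd r" "r < n" "r \<noteq> 1" using \<rho>[OF v(1)] ne1[OF v(1)] by auto
      then show "odd r \<and> 3 \<le> r \<and> r < n" by presburger
    qed (use assms n W in auto)
    then show ?thesis using \<open>M > 0\<close> n by simp
  qed
  also have "\<dots> \<le> M * \<bar>correlation n b b 1\<bar>" using bdb \<open>M > 0\<close> by simp
  also have "\<dots> = \<bar>c b * correlation n b b 1\<bar>" by (simp add: b abs_mult)
  finally show False by simp
qed

subsection \<open>Relations between tangents\<close>

lemma den_cases_numerator:
  assumes "prime n" "odd n" "x \<in> G" "0 < x" "x < pi / 2" "den x \<in> {n, 2 * n, 4 * n}"
  obtains a where "x = pi * real a / (4 * real n)" "0 < a" "a < 2 * n" "\<not> n dvd a"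
proof -
  have n: "n > 0" "n \<ge> 3" using assms(1,2) prime_ge_2_nat[of n] by (auto elim!: oddE)
  obtain r where r: "x = of_rat r * pi" using assms(3) by (auto simp: G_def)
  obtain p q where pq: "quotient_of r = (p, q)" by fastforce
  have q: "q > 0" "coprime p q" "r = of_int p / of_int q"
    using pq quotient_of_denom_pos quotient_of_coprime quotient_of_div by blast+
  have "den x = nat q" by (simp add: r den_of_rat_pi pq)
  \<comment> \<open>The factor \<open>c\<close> brings the fraction to the common denominator
    \<open>4 * n\<close>.\<close>
  then have "\<exists>c \<in> {1, 2, 4}. q * c = 4 * int n" using assms(6) q(1) by auto
  then obtain c where c: "c \<in> {1, 2, 4}" "q * c = 4 * int n" by blast
  have "int n dvd q" using \<open>den x = nat q\<close> assms(6) q(1) by (auto simp: nat_eq_iff)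
  have xe: "x = pi * of_int (p * c) / (4 * real n)"
  proof -
    have "4 * real n = of_int (q * c)" by (simp add: c(2))
    then show ?thesis using q c(1) by (auto simp: r of_rat_divide)
  qed
  have nd: "\<not> int n dvd p * c"
  proof
    assume "int n dvd p * c"
    moreover have "prime (int n)" using assms(1) by simp
    ultimately have "int n dvd p \<or> int n dvd c" by (simp add: prime_dvd_mult_iff)
    then show False
    proof
      assume "int n dvd p"
      then have "is_unit (int n)" using \<open>int n dvd q\<close> q(2) by (meson coprime_common_divisor)
      then show False using n by simp
    next
      assume "int n dvd c"
      moreover have "c dvd 2 ^ 2" using c(1) by auto
      ultimately have "int n dvd 2 ^ 2" by (rule dvd_trans)
      then have "int n dvd 2" using assms(1) by (meson prime_dvd_power prime_int_nat_transfer prime_nat_int_transfer)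
      then have "int n \<le> 2" by (rule zdvd_imp_le) simp
      then show False using n by simp
    qed
  qed
  have "pi * of_int (p * c) > pi * 0"
    using assms(4) n unfolding xe by (simp add: zero_less_divide_iff)
  then have pos: "p * c > 0" by (simp only: mult_less_cancel_left_pos[OF pi_gt_zero] of_int_0_less_iff)
  have "pi * of_int (p * c) < pi * (2 * real n)"
    using assms(5) n unfolding xe by (simp add: field_simps)
  then have "of_int (p * c) < (of_int (2 * int n) :: real)"
    by (simp only: mult_less_cancel_left_pos[OF pi_gt_zero] of_int_mult of_int_numeral of_int_of_nat_eq)
  then have lt: "p * c < 2 * int n" by (simp only: of_int_less_iff)
  show thesis
  proof (rule that[of "nat (p * c)"])
    show "x = pi * real (nat (p * c)) / (4 * real n)" using xe pos by simp
    show "\<not> n dvd nat (p * c)" using nd pos by (simp add: nat_dvd_iff dvd_nat_abs_iff flip: int_dvd_int_iff)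
  qed (use pos lt in auto)
qed

text \<open>For an odd multiplier the reflected angle is an odd multiple of \<open>pi\<close> minus
  \<open>\<theta>\<close>, so \<open>cis\<close> becomes minus its conjugate and the two moduli are
  exchanged.\<close>

lemma logratio_reflect:
  assumes "n > 0" "a \<le> 2 * n"
  shows "logratio 1 (pi * real (2 * j + 1) * real (2 * n - a) / (2 * real n))
    = - logratio 1 (pi * real (2 * j + 1) * real a / (2 * real n))"
proof -
  define \<theta> where "\<theta> = pi * real (2 * j + 1) * real a / (2 * real n)"
  have "pi * real (2 * j + 1) * real (2 * n - a) / (2 * real n) = real (2 * j + 1) * pi + - \<theta>"
    using assms by (simp add: \<theta>_def field_simps of_nat_diff)
  moreover have "cis (real (2 * j + 1) * pi + - \<theta>) = - cnj (cis \<theta>)"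
  proof -
    have "cis (real (2 * j + 1) * pi) = - 1"
      by (simp only: complex_eq_iff cis.simps cos_npi sin_npi) simp
    then show ?thesis by (simp only: cis_mult[symmetric] cis_cnj) simp
  qed
  moreover have "cmod (1 + cnj (cis \<theta>)) = cmod (1 + cis \<theta>)" "cmod (1 - cnj (cis \<theta>)) = cmod (1 - cis \<theta>)"
    by (metis complex_cnj_add complex_cnj_diff complex_cnj_one complex_mod_cnj)+
  ultimately show ?thesis unfolding \<theta>_def[symmetric] by (simp add: logratio_def)
qed

text \<open>For odd \<open>a\<close>, the smaller of \<open>a\<close> and \<open>2 * n - a\<close>
  is below \<open>n\<close>. For even \<open>a\<close>, the two add up to 2 modulo 4, so one of them
  is divisible by 4. The sign \<open>\<epsilon>\<close> records whether \<open>a\<close> was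
  replaced by its complement.\<close>

lemma canonical_representative:
  assumes "odd n" "0 < a" "a < 2 * n" "\<not> n dvd a"
  obtains v and \<epsilon> :: real where "canonical n v" "v = a \<and> \<epsilon> = 1 \<or> v = 2 * n - a \<and> \<epsilon> = - 1"
proof -
  have n: "n > 0" using assms by (cases n) auto
  have nd: "\<not> n dvd 2 * n - a" 
    using assms dvd_diffD[of n "2 * n" a] dvd_diff_nat[of n "2 * n" "2 * n - a"] by auto
  have "canonical n a \<or> canonical n (2 * n - a)"
  proof (cases "odd a")
    case True
    have "a \<noteq> n" using assms by auto
    then show ?thesis using True assms nd by (auto simp: canonical_def)
  next
    case False
    have "4 dvd a \<or> 4 dvd 2 * n - a" using False assms(1,3) by presburger
    then show ?thesis using assms nd by (auto simp: canonical_def)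
  qed
  then show thesis using that by blast
qed

text \<open>Expresses the tangent through a root of unity without denominators, so that the tangent
  relation becomes polynomial.\<close>

lemma cis_double_minus_one:
  assumes "cos \<phi> \<noteq> 0"
  shows "cis (2 * \<phi>) - 1 = \<i> * of_real (tan \<phi>) * (cis (2 * \<phi>) + 1)"
proof -
  have "cos (2 * \<phi>) - 1 = - (tan \<phi> * sin (2 * \<phi>))"
    using assms by (simp add: tan_def sin_double cos_double_sin power2_eq_square)
  moreover have "sin (2 * \<phi>) = tan \<phi> * (cos (2 * \<phi>) + 1)"
    using assms by (simp add: tan_def sin_double cos_double_cos power2_eq_square)
  ultimately show ?thesis by (simp add: complex_eq_iff)
qed

lemma logratio_relation:
  fixes a :: "nat \<Rightarrow> nat"
  assumes "prime n" "odd n"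
    and a: "\<And>i. i \<le> 4 \<Longrightarrow> 0 < a i \<and> a i < 2 * n \<and> \<not> n dvd a i"
    and tan: "(tan (pi * real (a 0) / (4 * real n)))\<^sup>2 = (\<Prod>i\<in>{1..4}. tan (pi * real (a i) / (4 * real n)))"
    and j: "\<not> n dvd 2 * j + 1"
  defines "L \<equiv> \<lambda>i. logratio 1 (pi * real (2 * j + 1) * real (a i) / (2 * real n))"
  shows "2 * L 0 = (\<Sum>i\<in>{1..4}. L i)"
proof -
  have n: "n > 0" using assms(1) by (simp add: prime_gt_0_nat)
  define z where "z = cis (pi / (2 * real n))"
  \<comment> \<open>The tangent relation with denominators cleared. The plus sign arises because the
    left side contributes \<open>\<i> ^ 2 = - 1\<close> and the right side
    \<open>\<i> ^ 4 = 1\<close>.\<close>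
  define P :: "int poly" where "P = (monom 1 (a 0) - 1) ^ 2 * (\<Prod>i\<in>{1..4}. monom 1 (a i) + 1)
    + (monom 1 (a 0) + 1) ^ 2 * (\<Prod>i\<in>{1..4}. monom 1 (a i) - 1)"
  have I: "{1..4} = {1, 2, 3, 4 :: nat}" by auto
  have P: "ipoly_eval P w = (w ^ a 0 - 1) ^ 2 * (\<Prod>i\<in>{1..4}. w ^ a i + 1)
    + (w ^ a 0 + 1) ^ 2 * (\<Prod>i\<in>{1..4}. w ^ a i - 1)" for w
    unfolding P_def I by simp
  have z1: "z ^ a i - 1 = \<i> * of_real (tan (pi * real (a i) / (4 * real n))) * (z ^ a i + 1)" if "i \<le> 4" for i
  proof -
    have e: "z ^ a i = cis (2 * (pi * real (a i) / (4 * real n)))"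
      by (simp add: z_def Complex.DeMoivre field_simps)
    have "0 < pi * real (a i) / (4 * real n)" "pi * real (a i) / (4 * real n) < pi / 2"
      using a[OF that] n by (simp_all add: field_simps)
    then have "cos (pi * real (a i) / (4 * real n)) > 0" by (intro cos_gt_zero_pi) auto
    then show ?thesis unfolding e by (intro cis_double_minus_one) simp
  qed
  have "ipoly_eval P z = 0"
  proof -
    define T where "T i = complex_of_real (tan (pi * real (a i) / (4 * real n)))" for i
    have "T 0 ^ 2 = T 1 * T 2 * T 3 * T 4"
      using arg_cong[OF tan, of complex_of_real] unfolding T_def I by (simp add: mult.assoc)
    moreover have "z ^ a i - 1 = \<i> * T i * (z ^ a i + 1)" if "i \<le> 4" for i
      using z1[OF that] by (simp add: T_def)
    ultimately show ?thesis unfolding P I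
      by (simp add: power_mult_distrib mult_ac)
  qed
  moreover have "z ^ (4 * n) = 1" using n by (simp add: z_def Complex.DeMoivre)
  moreover have "coprime (2 * j + 1) (4 * n)"
  proof -
    have "coprime (2 * j + 1) (2 * 2)" unfolding coprime_mult_right_iff by simp
    moreover have "coprime (2 * j + 1) n" using j assms(1) by (metis coprime_commute prime_imp_coprime)
    ultimately show ?thesis by simp
  qed
  ultimately have "ipoly_eval P (z ^ (2 * j + 1)) = 0"
    using n by (intro root_of_unity_conjugate[of z "4 * n"]) auto
  define w where "w i = cis (pi * real (2 * j + 1) * real (a i) / (2 * real n))" for i
  have "(z ^ (2 * j + 1)) ^ a i = w i" for i
    unfolding z_def w_def Complex.DeMoivre by (simp add: algebra_simps)
  then have "(w 0 - 1) ^ 2 * (\<Prod>i\<in>{1..4}. w i + 1) = - ((w 0 + 1) ^ 2 * (\<Prod>i\<in>{1..4}. w i - 1))"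
    using \<open>ipoly_eval P (z ^ (2 * j + 1)) = 0\<close> unfolding P by (simp add: eq_neg_iff_add_eq_0)
  \<comment> \<open>Absolute values discard the sign that conjugation may introduce into the tangent
    relation.\<close>
  from arg_cong[OF this, of cmod]
  have eq: "cmod (1 - w 0) ^ 2 * (cmod (1 + w 1) * cmod (1 + w 2) * cmod (1 + w 3) * cmod (1 + w 4))
    = cmod (1 + w 0) ^ 2 * (cmod (1 - w 1) * cmod (1 - w 2) * cmod (1 - w 3) * cmod (1 - w 4))"
    unfolding I by (simp add: norm_mult norm_power norm_minus_commute add.commute mult.assoc)
  have nz: "cmod (1 - w i) > 0 \<and> cmod (1 + w i) > 0" if "i \<le> 4" for i
  proof -
    have "\<not> n dvd (2 * j + 1) * a i" using j a[OF that] assms(1) by (simp only: prime_dvd_mult_iff) simp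
    then have "sin (pi * real (2 * j + 1) * real (a i) / (2 * real n)) \<noteq> 0"
      using sin_angle_nonzero[OF n, of "(2 * j + 1) * a i"] by (simp only: of_nat_mult mult.assoc) simp
    then have "1 - w i \<noteq> 0" "1 + w i \<noteq> 0" by (auto simp: w_def complex_eq_iff)
    then show ?thesis by simp
  qed
  have L: "L i = ln (cmod (1 - w i)) - ln (cmod (1 + w i))" for i
    by (simp add: L_def logratio_def w_def)
  from arg_cong[OF eq, of ln] nz[of 0] nz[of 1] nz[of 2] nz[of 3] nz[of 4]
  show ?thesis unfolding I by (simp add: ln_mult ln_realpow L)
qed

text \<open>The balance at \<open>v 0\<close> forces two of the four terms to agree with term 0 in
  value and sign; once these are removed, the other two must cancel each other.\<close>

lemma signed_matching:
  fixes v :: "nat \<Rightarrow> nat" and \<epsilon> :: "nat \<Rightarrow> real"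
  assumes \<epsilon>: "\<And>i. i \<le> 4 \<Longrightarrow> \<epsilon> i = 1 \<or> \<epsilon> i = - 1"
    and bal: "\<And>k. k \<le> 4 \<Longrightarrow> 2 * of_bool (v 0 = v k) * \<epsilon> 0 = (\<Sum>i\<in>{1..4}. of_bool (v i = v k) * \<epsilon> i)"
  shows "\<exists>p1 p2 p3 p4. {p1, p2, p3, p4} = {1, 2, 3, 4} \<and> v p1 = v 0 \<and> \<epsilon> p1 = \<epsilon> 0 \<and>
    v p2 = v 0 \<and> \<epsilon> p2 = \<epsilon> 0 \<and> v p3 = v p4 \<and> \<epsilon> p3 = - \<epsilon> p4"
proof -
  have I: "{1..4} = {1, 2, 3, 4 :: nat}" by auto
  \<comment> \<open>\<open>y i\<close> is 1 if term \<open>i\<close> agrees with term 0, -1 if it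
    has the same value and opposite sign, and 0 otherwise. A total of 2 requires two positive
    entries.\<close>
  define y where "y i = of_bool (v i = v 0) * \<epsilon> i * \<epsilon> 0" for i
  have y: "v i = v 0 \<and> \<epsilon> i = \<epsilon> 0 \<or> y i \<le> 0" "y i \<le> 1" if "i \<le> 4" for i
    using \<epsilon>[OF that] \<epsilon>[of 0] by (auto simp: y_def)
  have "(\<Sum>i\<in>{1..4}. y i) = (\<Sum>i\<in>{1..4}. of_bool (v i = v 0) * \<epsilon> i) * \<epsilon> 0"
    by (simp only: y_def sum_distrib_right)
  also have "\<dots> = 2 * \<epsilon> 0 * \<epsilon> 0"
    by (subst bal[of 0, symmetric]) simp_all
  also have "\<dots> = 2" using \<epsilon>[of 0] by auto
  finally have "y 1 + y 2 + y 3 + y 4 = 2" unfolding I by simp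
  then consider "y 1 > 0" "y 2 > 0" | "y 1 > 0" "y 3 > 0" | "y 1 > 0" "y 4 > 0"
    | "y 2 > 0" "y 3 > 0" | "y 2 > 0" "y 4 > 0" | "y 3 > 0" "y 4 > 0"
    using y(2)[of 1] y(2)[of 2] y(2)[of 3] y(2)[of 4] by linarith
  then have "\<exists>p1 p2 p3 p4. {p1, p2, p3, p4} = {1, 2, 3, 4} \<and> y p1 > 0 \<and> y p2 > 0"
  proof cases
    case 1 then show ?thesis by blast
  next
    case 2
    moreover have "{1, 3, 2, 4} = {1, 2, 3, 4 :: nat}" by auto
    ultimately show ?thesis by blast
  next
    case 3
    moreover have "{1, 4, 2, 3} = {1, 2, 3, 4 :: nat}" by auto
    ultimately show ?thesis by blast
  next
    case 4
    moreover have "{2, 3, 1, 4} = {1, 2, 3, 4 :: nat}" by auto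
    ultimately show ?thesis by blast
  next
    case 5
    moreover have "{2, 4, 1, 3} = {1, 2, 3, 4 :: nat}" by auto
    ultimately show ?thesis by blast
  next
    case 6
    moreover have "{3, 4, 1, 2} = {1, 2, 3, 4 :: nat}" by auto
    ultimately show ?thesis by blast
  qed
  then obtain p1 p2 p3 p4 where p: "{p1, p2, p3, p4} = {1, 2, 3, 4}" "y p1 > 0" "y p2 > 0" by blast
  have "p1 \<in> {p1, p2, p3, p4}" "p2 \<in> {p1, p2, p3, p4}" "p3 \<in> {p1, p2, p3, p4}" "p4 \<in> {p1, p2, p3, p4}" by auto
  then have le: "p1 \<le> 4" "p2 \<le> 4" "p3 \<le> 4" "p4 \<le> 4" unfolding p(1) by auto
  have m: "v p1 = v 0" "\<epsilon> p1 = \<epsilon> 0" "v p2 = v 0" "\<epsilon> p2 = \<epsilon> 0"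
    using y(1)[OF le(1)] y(1)[OF le(2)] p(2,3) by auto
  have "card {p1, p2, p3, p4} = 4" unfolding p(1) by simp
  then have "distinct [p1, p2, p3, p4]" by (intro card_distinct) simp
  \<comment> \<open>In the balance at \<open>v p3\<close>, the terms \<open>p1\<close> and
    \<open>p2\<close> cancel the left side, whether or not \<open>v p3 = v 0\<close>.\<close>
  then have "(\<Sum>i\<in>{p1, p2, p3, p4}. of_bool (v i = v p3) * \<epsilon> i) = of_bool (v p1 = v p3) * \<epsilon> p1
      + of_bool (v p2 = v p3) * \<epsilon> p2 + \<epsilon> p3 + of_bool (v p4 = v p3) * \<epsilon> p4"
    by simp
  then have "\<epsilon> p3 + of_bool (v p4 = v p3) * \<epsilon> p4 = 0"
    using bal[OF le(3)] unfolding I p(1) m by simp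
  then have "v p3 = v p4 \<and> \<epsilon> p3 = - \<epsilon> p4" 
    using \<epsilon>[OF le(3)] by (cases "v p4 = v p3") auto
  then show ?thesis using p(1) m by blast
qed

lemma permutes_of_enumeration:
  assumes "{p1, p2, p3, p4} = {1, 2, 3, 4 :: nat}"
  obtains \<sigma> where "\<sigma> permutes {1, 2, 3, 4}" "\<sigma> 1 = p1" "\<sigma> 2 = p2" "\<sigma> 3 = p3" "\<sigma> 4 = p4"
proof -
  define \<sigma> where "\<sigma> = id(1 := p1, 2 := p2, 3 := p3, 4 := p4)"
  have img: "\<sigma> ` {1, 2, 3, 4} = {1, 2, 3, 4}" using assms by (simp add: \<sigma>_def)
  then have "inj_on \<sigma> {1, 2, 3, 4}" by (intro eq_card_imp_inj_on) auto
  then have "bij_betw \<sigma> {1, 2, 3, 4} {1, 2, 3, 4}" using img by (simp add: bij_betw_def)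
  then have "\<sigma> permutes {1, 2, 3, 4}"
    by (rule bij_imp_permutes) (simp add: \<sigma>_def)
  then show thesis by (rule that) (simp_all add: \<sigma>_def)
qed

theorem theorem7p1:
  fixes n :: nat and x :: "nat \<Rightarrow> real"
  assumes "prime n" and "odd n"
    and "\<And>i. i \<in> {0..4} \<Longrightarrow> x i \<in> G"
    and "(tan (x 0))\<^sup>2 = tan (x 1) * tan (x 2) * tan (x 3) * tan (x 4)"
    and "\<And>i. i \<in> {0..4} \<Longrightarrow> 0 < x i \<and> x i < pi / 2"
    and "\<And>i. i \<in> {0..4} \<Longrightarrow> den (x i) \<in> {n, 2 * n, 4 * n}"
  shows "\<exists>(\<sigma> :: nat \<Rightarrow> nat) (s :: rat) (t :: rat).
    \<sigma> permutes {1, 2, 3, 4} \<and> 0 < s \<and> s < 1 / 2 \<and> 0 < t \<and> t \<le> 1 / 4 \<and>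
    x 0 = of_rat s * pi \<and>
    x (\<sigma> 1) = of_rat s * pi \<and> x (\<sigma> 2) = of_rat s * pi \<and>
    x (\<sigma> 3) = of_rat t * pi \<and> x (\<sigma> 4) = (1 / 2 - of_rat t) * pi"
proof -
  have n: "n > 0" using assms(1) by (simp add: prime_gt_0_nat)
  have I: "{1..4} = {1, 2, 3, 4 :: nat}" by auto
  have "\<exists>a. x i = pi * real a / (4 * real n) \<and> 0 < a \<and> a < 2 * n \<and> \<not> n dvd a" if "i \<le> 4" for i
    using den_cases_numerator[OF assms(1,2), of "x i"] assms(3,5,6)[of i] that by (metis atLeastAtMost_iff le0)
  then obtain a where x: "\<And>i. i \<le> 4 \<Longrightarrow> x i = pi * real (a i) / (4 * real n)"
    and a: "\<And>i. i \<le> 4 \<Longrightarrow> 0 < a i \<and> a i < 2 * n \<and> \<not> n dvd a i"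
    by metis
  have "\<exists>v \<epsilon>. canonical n v \<and> (v = a i \<and> \<epsilon> = (1 :: real) \<or> v = 2 * n - a i \<and> \<epsilon> = - 1)" if "i \<le> 4" for i
    using canonical_representative[OF assms(2), of "a i"] a[OF that] by metis
  then obtain v \<epsilon> where v: "\<And>i. i \<le> 4 \<Longrightarrow> canonical n (v i)"
    and ve: "\<And>i. i \<le> 4 \<Longrightarrow> v i = a i \<and> \<epsilon> i = (1 :: real) \<or> v i = 2 * n - a i \<and> \<epsilon> i = - 1"
    by metis
  define F where "F j m = logratio 1 (pi * real (2 * j + 1) * real m / (2 * real n))" for j m
  have F: "F j (a i) = \<epsilon> i * F j (v i)" if "i \<le> 4" for i j
    using ve[OF that] a[OF that] logratio_reflect[OF n, of "a i" j] unfolding F_def by auto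
  have rel: "2 * F j (a 0) = (\<Sum>i\<in>{1..4}. F j (a i))" if "\<not> n dvd 2 * j + 1" for j
    unfolding F_def
  proof (rule logratio_relation[OF assms(1,2) a _ that])
    show "(tan (pi * real (a 0) / (4 * real n)))\<^sup>2 = (\<Prod>i\<in>{1..4}. tan (pi * real (a i) / (4 * real n)))"
      using assms(4) x[of 0] x[of 1] x[of 2] x[of 3] x[of 4] unfolding I by (simp add: mult.assoc)
  qed
  define V where "V = v ` {..4}"
  \<comment> \<open>The total coefficient of \<open>F j u\<close> after terms with equal canonical
    numerator are collected.\<close>
  define c where "c u = 2 * of_bool (v 0 = u) * \<epsilon> 0 - (\<Sum>i\<in>{1..4}. of_bool (v i = u) * \<epsilon> i)" for u
  have fV: "finite V" by (simp add: V_def)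
  have pick: "(\<Sum>u\<in>V. of_bool (v i = u) * \<epsilon> i * F j u) = \<epsilon> i * F j (v i)" if "i \<le> 4" for i j
  proof -
    have "(\<Sum>u\<in>V. of_bool (v i = u) * \<epsilon> i * F j u) = (\<Sum>u\<in>V. if v i = u then \<epsilon> i * F j u else 0)"
      by (intro sum.cong) auto
    then show ?thesis using that fV by (simp add: V_def)
  qed
  have c0: "c u = 0" if "u \<in> V" for u
  proof (rule logratio_independent[OF assms(1,2) fV _ _ _ that])
    show "card V \<le> 5" unfolding V_def using card_image_le[of "{..4 :: nat}" v] by simp
    show "canonical n w" if "w \<in> V" for w using that v by (auto simp: V_def)
    fix j assume j: "\<not> n dvd 2 * j + 1"
    have "(\<Sum>u\<in>V. c u * F j u) = 2 * (\<Sum>u\<in>V. of_bool (v 0 = u) * \<epsilon> 0 * F j u)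
        - (\<Sum>i\<in>{1..4}. \<Sum>u\<in>V. of_bool (v i = u) * \<epsilon> i * F j u)"
      unfolding c_def left_diff_distrib sum_subtractf sum_distrib_right sum_distrib_left
      by (subst sum.swap) (simp add: mult_ac)
    also have "\<dots> = 2 * F j (a 0) - (\<Sum>i\<in>{1..4}. F j (a i))"
      using F by (simp add: pick)
    finally show "(\<Sum>u\<in>V. c u * logratio 1 (pi * real (2 * j + 1) * real u / (2 * real n))) = 0"
      using rel[OF j] by (simp only: F_def)
  qed
  have "\<exists>p1 p2 p3 p4. {p1, p2, p3, p4} = {1, 2, 3, 4} \<and> v p1 = v 0 \<and> \<epsilon> p1 = \<epsilon> 0 \<and>
    v p2 = v 0 \<and> \<epsilon> p2 = \<epsilon> 0 \<and> v p3 = v p4 \<and> \<epsilon> p3 = - \<epsilon> p4"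
  proof (rule signed_matching)
    show "\<epsilon> i = 1 \<or> \<epsilon> i = - 1" if "i \<le> 4" for i using ve[OF that] by blast
    show "2 * of_bool (v 0 = v k) * \<epsilon> 0 = (\<Sum>i\<in>{1..4}. of_bool (v i = v k) * \<epsilon> i)" if "k \<le> 4" for k
      using c0[of "v k"] that by (simp add: c_def V_def)
  qed
  then obtain p1 p2 q3 q4 where p: "{p1, p2, q3, q4} = {1, 2, 3, 4}"
    "v p1 = v 0" "\<epsilon> p1 = \<epsilon> 0" "v p2 = v 0" "\<epsilon> p2 = \<epsilon> 0" "v q3 = v q4" "\<epsilon> q3 = - \<epsilon> q4" by blast
  have "p1 \<in> {p1, p2, q3, q4}" "p2 \<in> {p1, p2, q3, q4}" "q3 \<in> {p1, p2, q3, q4}" "q4 \<in> {p1, p2, q3, q4}" by auto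
  then have le: "p1 \<le> 4" "p2 \<le> 4" "q3 \<le> 4" "q4 \<le> 4" unfolding p(1) by auto
  \<comment> \<open>A canonical numerator and its sign determine the original numerator; opposite
    signs mean complementary angles.\<close>
  have a12: "a p1 = a 0" "a p2 = a 0"
    using ve[OF le(1)] ve[OF le(2)] ve[of 0] a[OF le(1)] a[OF le(2)] a[of 0] p by auto
  have a34: "a q3 + a q4 = 2 * n"
    using ve[OF le(3)] ve[OF le(4)] a[OF le(3)] a[OF le(4)] p by auto
  \<comment> \<open>The complementary pair is ordered with the smaller angle first, which gives
    \<open>t \<le> 1 / 4\<close>.\<close>
  obtain p3 p4 where q: "{p1, p2, p3, p4} = {1, 2, 3, 4}" "a p3 + a p4 = 2 * n" "a p3 \<le> n"
    "p3 \<le> 4" "p4 \<le> 4"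
  proof (cases "a q3 \<le> n")
    case True
    then show thesis using that[of q3 q4] p(1) a34 le by blast
  next
    case False
    moreover have "{p1, p2, q4, q3} = {1, 2, 3, 4}" using p(1) by (simp add: insert_commute)
    ultimately show thesis using that[of q4 q3] a34 le by simp
  qed
  obtain \<sigma> where \<sigma>: "\<sigma> permutes {1, 2, 3, 4}" "\<sigma> 1 = p1" "\<sigma> 2 = p2" "\<sigma> 3 = p3" "\<sigma> 4 = p4"
    using permutes_of_enumeration[OF q(1)] .
  define s t :: rat where "s = of_nat (a 0) / of_nat (4 * n)" and "t = of_nat (a p3) / of_nat (4 * n)"
  have s: "of_rat s * pi = x 0" "of_rat t * pi = x p3"
    using x[of 0] x[OF q(4)] by (simp_all add: s_def t_def of_rat_divide of_rat_mult)
  have "x p4 = (1 / 2 - of_rat t) * pi"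
  proof -
    have "real (a p4) = 2 * real n - real (a p3)" using q(2) by linarith
    then have "x p4 = pi * (2 * real n - real (a p3)) / (4 * real n)" using x[OF q(5)] by simp
    then show ?thesis using n
      by (simp add: t_def of_rat_divide of_rat_mult field_simps)
  qed
  moreover have "x p1 = x 0" "x p2 = x 0" using x le a12 by simp_all
  moreover have "0 < s" "0 < t" using a[of 0] a[OF q(4)] n by (simp_all add: s_def t_def)
  moreover have "s < 1 / 2"
  proof -
    have "(of_nat (a 0) :: rat) < of_nat (2 * n)" using a[of 0] by (simp only: of_nat_less_iff)
    then show ?thesis using n by (simp add: s_def field_simps)
  qed
  moreover have "t \<le> 1 / 4"
  proof -
    have "(of_nat (a p3) :: rat) \<le> of_nat n" using q(3) by (simp only: of_nat_le_iff)
    then show ?thesis using n by (simp add: t_def field_simps)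
  qed
  ultimately show ?thesis using \<sigma> s by (intro exI[of _ \<sigma>] exI[of _ s] exI[of _ t]) simp
qed

end
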